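(* Let $T<\min(T^*,t_* )$. Let $(L_t)$ be the loss function of the McKean--Vlasov system and, for $n\ge 1$ and $h=T/n$, let $(\tilde L_{t_i})_{0\le i\le n}$ be the loss function of the discretized process on the uniform mesh $t_i=ih$, all as defined in the context. Then, for any $\delta>0$, there exists $C>0$ independent of $h$ such that $$\max_{i\le n}\,|\tilde L_{t_i}-L_{t_i}|\le C\,h^{\frac12-\delta}.$$
   Context: Setting: $\alpha,T\in\mathbb{R}_+$ (positive); $W$ is a standard Brownian motion on a filtered probability space $(\Omega,\mathcal F,(\mathcal F_t)_{t\ge0},\mathbb P)$, and $Y_0$ is an $\mathbb{R}_+$-valued random variable independent of $W$. McKean--Vlasov system: $Y_t=Y_0+W_t-\alpha L_t$, $L_t=\mathbb P(\tau\le t)$, $\tau=\inf\{t: Y_t\le 0\}$ ($t\in[0,T]$). Assumption on $Y_0$: $Y_0$ has a density $f_{Y_0}$ supported on $\mathbb R_+$ with $f_{Y_0}(x)\le B x^{\beta}$ for all $x\ge0$, for some $\beta\in(0,1]$ and a constant $B$. Known fact (existence and regularity, taken as background): under this assumption there is a unique differentiable solution $t\mapsto L_t$ of the system up to the explosion time $t_*:=\sup\{t>0:\|L\|_{H^1(0,t)}<\infty\}\in[0,\infty]$, and there is a constant $\hat B$ with $L_t'\le\hat B\,t^{-\frac{1-\beta}{2}}$ for a.e. $t<t_*$. Consequently $L_t\le\tilde B\,t^{\frac{1+\beta}{2}}$ for $t<t_*$ for some constant $\tilde B$ (e.g. $\tilde B=2\hat B/(1+\beta)$). $L$ denotes this solution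 and $Y$ the corresponding process. Definition of $T^*$: $T^*$ is defined by $$\alpha B\left[\sqrt{\tfrac{2T^*}{\pi}}+\alpha\tilde B\,(T^* )^{\frac{1+\beta}{2}}\right]^{\beta}=1,$$ with $B$ and $\tilde B$ the smallest constants such that $f_{Y_0}(x)\le Bx^\beta$ for all $x\ge 0$ and $L_t\le\tilde B t^{\frac{1+\beta}{2}}$ for all $t<t_*$ hold for the given $\beta$. Discretized process on the uniform mesh $0=t_0<t_1<\dots<t_n=T$, $t_i-t_{i-1}=h$: $\tilde Y_{t_0}=Y_0$, $\tilde L_{t_0}=0$, and for $1\le i\le n$, $$\tilde Y_{t_i}=Y_0+W_{t_i}-\alpha\tilde L_{t_i},\qquad \tilde L_{t_i}=\mathbb P(\tilde\tau<t_i),\qquad \tilde\tau=\min\{t_j:0\le j\le n,\ \tilde Y_{t_j}\le0\}$$ (with $\min\emptyset=\infty$). Thus $\tilde L_{t_i}=\mathbb P(\min_{j<i}\tilde Y_{t_j}\le 0)$, so the scheme is explicit. *)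

theory Defs
  imports "HOL-Probability.Probability"
begin

text \<open>
  The library's locale \<open>filtration\<close> would constrain \<open>F t\<close> at negative times as well.
\<close>

definition filtration_nonneg :: "'a measure \<Rightarrow> (real \<Rightarrow> 'a measure) \<Rightarrow> bool" where
  "filtration_nonneg M F \<longleftrightarrow>
     (\<forall>t\<ge>0. subalgebra M (F t)) \<and> (\<forall>s t. 0 \<le> s \<longrightarrow> s \<le> t \<longrightarrow> subalgebra (F t) (F s))"

definition standard_brownian_motion ::
    "'a measure \<Rightarrow> (real \<Rightarrow> 'a measure) \<Rightarrow> (real \<Rightarrow> 'a \<Rightarrow> real) \<Rightarrow> bool" where
  "standard_brownian_motion M F W \<longleftrightarrow>
     prob_space M \<and> filtration_nonneg M F \<and>
     (\<forall>t\<ge>0. W t \<in> borel_measurable (F t)) \<and>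
     (AE \<omega> in M. W 0 \<omega> = 0) \<and>
     (AE \<omega> in M. continuous_on {0..} (\<lambda>t. W t \<omega>)) \<and>
     (\<forall>s t. 0 \<le> s \<longrightarrow> s < t \<longrightarrow>
        distributed M lborel (\<lambda>\<omega>. W t \<omega> - W s \<omega>) (\<lambda>x. ennreal (normal_density 0 (sqrt (t - s)) x)) \<and>
        prob_space.indep_set M (sets (F s))
          (sets (vimage_algebra (space M) (\<lambda>\<omega>. W t \<omega> - W s \<omega>) borel)))"

text \<open>
  Independence of random variables with values in different types, which the library's
  \<open>indep_var\<close> does not cover; the process \<open>W\<close> is a random variable with values in the product
  \<open>\<real>\<^bsup>[0, \<infinity>)\<^esup>\<close>.
\<close>

definition indep_of_process ::
    "'a measure \<Rightarrow> ('a \<Rightarrow> real) \<Rightarrow> (real \<Rightarrow> 'a \<Rightarrow> real) \<Rightarrow> bool" where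
  "indep_of_process M X W \<longleftrightarrow>
     prob_space.indep_set M (sets (vimage_algebra (space M) X borel))
       (sets (vimage_algebra (space M) (\<lambda>\<omega>. \<lambda>t\<in>{0..}. W t \<omega>) (Pi\<^sub>M {0..} (\<lambda>_. borel))))"

text \<open>
  Weak derivatives on the interval \<open>(a, b)\<close>, tested against continuously differentiable functions
  with compact support in \<open>(a, b)\<close>, as in Brezis, Functional Analysis, Sobolev Spaces and
  Partial Differential Equations, Section 8.2.
\<close>

definition weak_derivative_on :: "real \<Rightarrow> real \<Rightarrow> (real \<Rightarrow> real) \<Rightarrow> (real \<Rightarrow> real) \<Rightarrow> bool" where
  "weak_derivative_on a b u g \<longleftrightarrow>
     (\<forall>c d. a < c \<longrightarrow> d < b \<longrightarrow> set_integrable lborel {c..d} u \<and> set_integrable lborel {c..d} g) \<and>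
     (\<forall>\<phi> \<phi>'. (\<forall>x\<in>{a<..<b}. (\<phi> has_real_derivative \<phi>' x) (at x)) \<longrightarrow>
        continuous_on {a<..<b} \<phi>' \<longrightarrow>
        (\<exists>c d. a < c \<and> d < b \<and> (\<forall>x\<in>{a<..<b}. x \<notin> {c..d} \<longrightarrow> \<phi> x = 0)) \<longrightarrow>
        (LINT x:{a<..<b}|lborel. u x * \<phi>' x) = - (LINT x:{a<..<b}|lborel. g x * \<phi> x))"

text \<open>
  The square of the \<open>H\<^sup>1(a, b)\<close> norm. Weak derivatives are unique almost everywhere, so the infimum
  is over a single value, or over the empty set (and then \<open>\<infinity>\<close>) if there is no weak derivative.
\<close>

definition H1_norm_sq :: "real \<Rightarrow> real \<Rightarrow> (real \<Rightarrow> real) \<Rightarrow> ennreal" where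
  "H1_norm_sq a b u =
     (INF g \<in> {g. weak_derivative_on a b u g}.
        \<integral>\<^sup>+x\<in>{a<..<b}. ennreal ((u x)\<^sup>2 + (g x)\<^sup>2) \<partial>lborel)"

text \<open>Times live in \<open>[0, \<infinity>]\<close>, with \<open>sup \<emptyset> = 0\<close> and \<open>inf \<emptyset> = \<infinity>\<close>.\<close>

definition explosion_time :: "(real \<Rightarrow> real) \<Rightarrow> ennreal" where
  "explosion_time L = (SUP t \<in> {t. 0 < t \<and> H1_norm_sq 0 t L < \<infinity>}. ennreal t)"

definition hitting_time :: "(real \<Rightarrow> 'a \<Rightarrow> real) \<Rightarrow> 'a \<Rightarrow> ennreal" where
  "hitting_time Y \<omega> = (INF t \<in> {t. 0 \<le> t \<and> Y t \<omega> \<le> 0}. ennreal t)"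

text \<open>
  \<open>L\<close> solves the McKean--Vlasov system up to its explosion time, and is differentiable there in the
  sense of the definition of that time. For \<open>t\<close> below the explosion time the event
  \<open>\<tau> \<le> t\<close> depends on \<open>L\<close> only through its values below the explosion time. That it is an
  event is required explicitly, since \<^const>\<open>measure\<close> is \<open>0\<close> on non-measurable sets.
\<close>

definition mckean_vlasov_solution ::
    "'a measure \<Rightarrow> ('a \<Rightarrow> real) \<Rightarrow> (real \<Rightarrow> 'a \<Rightarrow> real) \<Rightarrow> real \<Rightarrow> (real \<Rightarrow> real) \<Rightarrow> bool" where
  "mckean_vlasov_solution M Y0 W \<alpha> L \<longleftrightarrow>
     (let \<tau> = hitting_time (\<lambda>t \<omega>. Y0 \<omega> + W t \<omega> - \<alpha> * L t) in
      \<forall>t\<ge>0. ennreal t < explosion_time L \<longrightarrow>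
        {\<omega> \<in> space M. \<tau> \<omega> \<le> ennreal t} \<in> sets M \<and>
        L t = measure M {\<omega> \<in> space M. \<tau> \<omega> \<le> ennreal t})"

definition discrete_hitting_time :: "real \<Rightarrow> nat \<Rightarrow> (nat \<Rightarrow> 'a \<Rightarrow> real) \<Rightarrow> 'a \<Rightarrow> ennreal" where
  "discrete_hitting_time h n Y \<omega> = (INF j \<in> {j. j \<le> n \<and> Y j \<omega> \<le> 0}. ennreal (real j * h))"

text \<open>\<open>Lt i\<close> is the discretized loss at the mesh point \<open>i h\<close>; its values for \<open>i > n\<close> are irrelevant.\<close>

definition discretized_loss ::
    "'a measure \<Rightarrow> ('a \<Rightarrow> real) \<Rightarrow> (real \<Rightarrow> 'a \<Rightarrow> real) \<Rightarrow> real \<Rightarrow> real \<Rightarrow> nat \<Rightarrow> (nat \<Rightarrow> real) \<Rightarrow> bool" where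
  "discretized_loss M Y0 W \<alpha> h n Lt \<longleftrightarrow>
     (let \<tau> = discrete_hitting_time h n (\<lambda>i \<omega>. Y0 \<omega> + W (real i * h) \<omega> - \<alpha> * Lt i) in
      Lt 0 = 0 \<and>
      (\<forall>i\<in>{1..n}. Lt i = measure M {\<omega> \<in> space M. \<tau> \<omega> < ennreal (real i * h)}))"

text \<open>The scheme is explicit, so it determines its loss function.\<close>

lemma discrete_hitting_time_less_iff:
  assumes "h > 0" "i \<le> n"
  shows "discrete_hitting_time h n Y \<omega> < ennreal (real i * h) \<longleftrightarrow> (\<exists>j<i. Y j \<omega> \<le> 0)"
proof -
  have *: "ennreal (real j * h) < ennreal (real i * h) \<longleftrightarrow> j < i" for j
    using assms(1) by (subst ennreal_less_iff) simp_all
  show ?thesis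
    unfolding discrete_hitting_time_def INF_less_iff *
    using assms(2) by (metis (no_types, lifting) less_imp_le less_le_trans mem_Collect_eq)
qed

lemma discretized_loss_iff:
  assumes "h > 0"
  shows "discretized_loss M Y0 W \<alpha> h n Lt \<longleftrightarrow>
    (\<forall>i\<le>n. Lt i = measure M {\<omega> \<in> space M. \<exists>j<i. Y0 \<omega> + W (real j * h) \<omega> - \<alpha> * Lt j \<le> 0})"
    (is "_ \<longleftrightarrow> (\<forall>i\<le>n. Lt i = ?R i)")
proof -
  have "?R 0 = 0" by simp
  show ?thesis
    (is "?D \<longleftrightarrow> ?E")
  proof -
    have "?D \<longleftrightarrow> Lt 0 = ?R 0 \<and> (\<forall>i\<in>{1..n}. Lt i = ?R i)"
      using assms \<open>?R 0 = 0\<close>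
      by (simp add: discretized_loss_def discrete_hitting_time_less_iff)
    also have "\<dots> \<longleftrightarrow> (\<forall>i\<in>insert 0 {1..n}. Lt i = ?R i)"
      by blast
    also have "insert 0 {1..n} = {..n}"
      by auto
    finally show ?thesis
      by (simp only: Ball_def atMost_iff)
  qed
qed

lemma discretized_loss_exists:
  assumes "h > 0"
  shows "\<exists>Lt. discretized_loss M Y0 W \<alpha> h n Lt"
proof (induction n)
  case 0
  show ?case by (rule exI[of _ "\<lambda>_. 0"]) (simp add: discretized_loss_def)
next
  case (Suc n)
  then obtain Lt where Lt: "discretized_loss M Y0 W \<alpha> h n Lt" by blast
  define v where
    "v = measure M {\<omega> \<in> space M. \<exists>j<Suc n. Y0 \<omega> + W (real j * h) \<omega> - \<alpha> * Lt j \<le> 0}"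
  have "discretized_loss M Y0 W \<alpha> h (Suc n) (Lt(Suc n := v))"
    unfolding discretized_loss_iff[OF assms]
  proof (intro allI impI)
    fix i assume i: "i \<le> Suc n"
    have *: "(\<exists>j<i. Y0 \<omega> + W (real j * h) \<omega> - \<alpha> * (Lt(Suc n := v)) j \<le> 0) \<longleftrightarrow>
        (\<exists>j<i. Y0 \<omega> + W (real j * h) \<omega> - \<alpha> * Lt j \<le> 0)" for \<omega>
      using i by (intro ex_cong1 conj_cong) simp_all
    show "(Lt(Suc n := v)) i = measure M {\<omega> \<in> space M.
        \<exists>j<i. Y0 \<omega> + W (real j * h) \<omega> - \<alpha> * (Lt(Suc n := v)) j \<le> 0}"
      unfolding * using i Lt[unfolded discretized_loss_iff[OF assms]]
      by (cases "i = Suc n") (auto simp: v_def)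
  qed
  then show ?case by blast
qed

lemma discretized_loss_unique:
  assumes "h > 0" "discretized_loss M Y0 W \<alpha> h n Lt" "discretized_loss M Y0 W \<alpha> h n Lt'" "i \<le> n"
  shows "Lt i = Lt' i"
  using \<open>i \<le> n\<close>
proof (induction i rule: less_induct)
  case (less i)
  have "(\<exists>j<i. Y0 \<omega> + W (real j * h) \<omega> - \<alpha> * Lt j \<le> 0) \<longleftrightarrow>
        (\<exists>j<i. Y0 \<omega> + W (real j * h) \<omega> - \<alpha> * Lt' j \<le> 0)" for \<omega>
    using less by auto
  then show ?case
    using assms(2,3) less.prems unfolding discretized_loss_iff[OF assms(1)] by simp
qed

end

theory Submission
  imports Defs
begin

text \<open>
  The explicit scheme uses the loss of the past only, so by induction along the mesh it never exceeds
  the true loss, and only an upper bound for \<open>e\<^sub>i = L t\<^sub>i - Lt i\<close> is needed. A path counted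
  by \<open>L\<close> but not by the scheme has an initial value in the random band
  \<open>D < Y0 \<le> D + \<rho>\<close>, where \<open>D\<close> is the maximum of \<open>\<alpha> Lt j - W t\<^sub>j\<close> over the earlier
  mesh points and \<open>\<rho> = \<alpha> E + \<alpha> C \<surd>h + R\<close> collects what the scheme misses: the largest
  error \<open>E\<close> on the mesh, the increment of \<open>L\<close> over a mesh interval and the largest drop \<open>R\<close> of
  \<open>W\<close> within one. Moreover \<open>Y0 \<le> V + \<alpha> L T\<close> with \<open>V = sup (-W)\<close>, as the true path reaches
  \<open>0\<close>. Everything except \<open>Y0\<close> depends on the Brownian path, so independence and the density bound
  give \<open>e\<^sub>i \<le> B \<E>[(V + \<alpha> L T)\<^sup>\<beta> \<rho>]\<close> (\<open>loss_minus_discretized_loss_le\<close>).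

  In the term with \<open>E\<close>, concavity of \<open>x\<^sup>\<beta>\<close>, \<open>\<E> V \<le> \<surd>(2 T / \<pi>)\<close> and the growth bound
  for \<open>L T\<close>, which replaces \<open>L T\<close> from the start in the proofs below, bring out precisely the quantity defining \<open>Tstar\<close>, so that \<open>E \<le> q E + r\<close> with \<open>q < 1\<close> because \<open>T < Tstar\<close>, and
  hence \<open>E \<le> r / (1 - q)\<close>. It remains to see that \<open>r\<close> is of order \<open>h\<close> to the power \<open>1/2 - \<delta>\<close>.

  For the increments of \<open>L\<close> this follows from \<open>L \<in> H\<^sup>1\<close>: a square integrable derivative makes
  \<open>L\<close> Hoelder continuous of order \<open>1/2\<close> (\<open>weak_derivative_increment_le\<close>,
  \<open>mckean_vlasov_loss_regular\<close>). For \<open>R\<close> it follows from the Gaussian moments of the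
  drops over the single mesh intervals, a sufficiently high moment making up for the number of
  intervals (\<open>expected_mesh_drop_le\<close>). Both the sharp constant in \<open>\<E> V\<close> and these moments come from
  Levy's maximal inequality \<open>P(max\<^sub>s (W a - W s) \<ge> x) \<le> 2 P(W a - W b \<ge> x)\<close>, half of the
  reflection principle, which rests on the symmetry of the increments and their independence of the past.
\<close>

section \<open>Hoelder continuity from a square integrable weak derivative\<close>

text \<open>Test functions have to be \<open>C\<^sup>1\<close>. Second differences of this function give one
   with a piecewise linear derivative in closed form.\<close>

lemma has_real_derivative_half_square_signed:
  fixes x :: real
  shows "((\<lambda>x. x * \<bar>x\<bar> / 2) has_real_derivative \<bar>x\<bar>) (at x)"
proof (cases x "0::real" rule: linorder_cases)
  case less
  have "((\<lambda>x. - (x * x / 2)) has_real_derivative \<bar>x\<bar>) (at x)"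
    using less by (auto intro!: derivative_eq_intros)
  moreover have "eventually (\<lambda>y. y * \<bar>y\<bar> / 2 = - (y * y / 2)) (nhds x)"
    using eventually_nhds_in_open[of "{..<0}" x] less by (auto elim!: eventually_mono)
  ultimately show ?thesis by (subst DERIV_cong_ev[OF refl _ refl])
next
  case equal
  have "((\<lambda>h::real. \<bar>h\<bar> / 2) \<longlongrightarrow> 0) (at 0)"
    by (auto intro!: tendsto_eq_intros)
  then have "((\<lambda>h::real. (h * \<bar>h\<bar> / 2) / h) \<longlongrightarrow> 0) (at 0)"
    by (rule Lim_transform_eventually) (auto simp: eventually_at_filter)
  then show ?thesis using equal by (simp add: DERIV_def)
next
  case greater
  have "((\<lambda>x. x * x / 2) has_real_derivative \<bar>x\<bar>) (at x)"
    using greater by (auto intro!: derivative_eq_intros)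
  moreover have "eventually (\<lambda>y. y * \<bar>y\<bar> / 2 = y * y / 2) (nhds x)"
    using eventually_nhds_in_open[of "{0<..}" x] greater by (auto elim!: eventually_mono)
  ultimately show ?thesis by (subst DERIV_cong_ev[OF refl _ refl])
qed

definition tent :: "real \<Rightarrow> real" where
  "tent x = (\<bar>x + 1\<bar> + \<bar>x - 1\<bar>) / 2 - \<bar>x\<bar>"

text \<open>The primitive of the tent that vanishes far to the left, a continuously differentiable step.\<close>

definition ramp :: "real \<Rightarrow> real" where
  "ramp x = ((x + 1) * \<bar>x + 1\<bar> / 2 + (x - 1) * \<bar>x - 1\<bar> / 2) / 2 - x * \<bar>x\<bar> / 2 + 1 / 2"

lemma tent_nonneg: "0 \<le> tent x"
  by (auto simp: tent_def abs_if)

lemma tent_eq_0: "1 \<le> \<bar>x\<bar> \<Longrightarrow> tent x = 0"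
  by (auto simp: tent_def abs_if split: if_splits)

lemma continuous_tent [continuous_intros]:
  "continuous_on A g \<Longrightarrow> continuous_on A (\<lambda>x. tent (g x))"
  unfolding tent_def by (auto intro!: continuous_intros)

lemma DERIV_ramp: "(ramp has_real_derivative tent x) (at x)"
proof -
  define P where "P c x = (x + c) * \<bar>x + c\<bar> / 2" for c x :: real
  have d: "(P c has_real_derivative \<bar>x + c\<bar>) (at x)" for c
    using has_real_derivative_half_square_signed[of "x + c"]
    unfolding P_def[abs_def] by (simp add: DERIV_shift)
  have "((\<lambda>x. (P 1 x + P (-1) x) / 2 - P 0 x + 1 / 2) has_real_derivative
      (\<bar>x + 1\<bar> + \<bar>x + -1\<bar>) / 2 - \<bar>x + 0\<bar> + 0) (at x)"
    by (intro DERIV_add DERIV_diff DERIV_cdivide DERIV_const d)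
  moreover have "ramp = (\<lambda>x. (P 1 x + P (-1) x) / 2 - P 0 x + 1 / 2)"
    by (auto simp: ramp_def P_def fun_eq_iff)
  ultimately show ?thesis by (simp add: tent_def)
qed

lemma DERIV_ramp_affine:
  assumes "0 < \<epsilon>"
  shows "((\<lambda>x. ramp ((x - u) / \<epsilon>)) has_real_derivative tent ((x - u) / \<epsilon>) / \<epsilon>) (at x)"
proof -
  have "((\<lambda>x. (x - u) / \<epsilon>) has_real_derivative 1 / \<epsilon>) (at x)"
    using assms by (auto intro!: derivative_eq_intros)
  from DERIV_chain2[OF DERIV_ramp this] show ?thesis by simp
qed

lemma ramp_eq_0:
  assumes "x \<le> -1"
  shows "ramp x = 0"
proof -
  have "\<bar>x + 1\<bar> = - (x + 1)" "\<bar>x - 1\<bar> = - (x - 1)" "\<bar>x\<bar> = - x" using assms by auto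
  then show ?thesis unfolding ramp_def by (simp only:) (simp add: field_simps)
qed

lemma ramp_eq_1:
  assumes "1 \<le> x"
  shows "ramp x = 1"
proof -
  have "\<bar>x + 1\<bar> = x + 1" "\<bar>x - 1\<bar> = x - 1" "\<bar>x\<bar> = x" using assms by auto
  then show ?thesis unfolding ramp_def by (simp only:) (simp add: field_simps)
qed

lemma ramp_mono: "x \<le> y \<Longrightarrow> ramp x \<le> ramp y"
  using DERIV_nonneg_imp_nondecreasing[of x y ramp] DERIV_ramp tent_nonneg by blast

lemma ramp_bounds: "0 \<le> ramp x" "ramp x \<le> 1"
  using ramp_mono[of "min x (-1)" x] ramp_eq_0[of "min x (-1)"]
    ramp_mono[of x "max x 1"] ramp_eq_1[of "max x 1"] by auto

lemma has_bochner_integral_tent: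
  assumes "0 < \<epsilon>" "{u - \<epsilon>..u + \<epsilon>} \<subseteq> S" 
  shows "has_bochner_integral lborel (\<lambda>x. indicator S x * (tent ((x - u) / \<epsilon>) / \<epsilon>)) 1"
proof -
  have 1: "has_bochner_integral lborel
      (\<lambda>x. tent ((x - u) / \<epsilon>) / \<epsilon> * indicator {u - \<epsilon>..u + \<epsilon>} x)
      (ramp ((u + \<epsilon> - u) / \<epsilon>) - ramp ((u - \<epsilon> - u) / \<epsilon>))"
  proof (rule has_bochner_integral_FTC_Icc_real)
    fix x
    show "((\<lambda>x. ramp ((x - u) / \<epsilon>)) has_real_derivative tent ((x - u) / \<epsilon>) / \<epsilon>) (at x)"
      using assms(1) by (rule DERIV_ramp_affine)
    have "continuous_on UNIV (\<lambda>x. tent ((x - u) / \<epsilon>) / \<epsilon>)"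
      using assms(1) by (intro continuous_intros) auto
    then show "isCont (\<lambda>x. tent ((x - u) / \<epsilon>) / \<epsilon>) x"
      by (simp add: continuous_on_eq_continuous_at)
  qed (use assms in auto)
  have "tent ((x - u) / \<epsilon>) / \<epsilon> * indicator {u - \<epsilon>..u + \<epsilon>} x =
      indicator S x * (tent ((x - u) / \<epsilon>) / \<epsilon>)" for x
  proof (cases "x \<in> {u - \<epsilon>..u + \<epsilon>}")
    case True
    then show ?thesis using assms by auto
  next
    case False
    then have "1 \<le> \<bar>(x - u) / \<epsilon>\<bar>"
      using assms(1) by (auto simp: abs_if field_simps)
    then show ?thesis using False by (simp add: tent_eq_0)
  qed
  then have "(\<lambda>x. tent ((x - u) / \<epsilon>) / \<epsilon> * indicator {u - \<epsilon>..u + \<epsilon>} x) =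
      (\<lambda>x. indicator S x * (tent ((x - u) / \<epsilon>) / \<epsilon>))" by (rule ext)
  moreover have "ramp ((u + \<epsilon> - u) / \<epsilon>) - ramp ((u - \<epsilon> - u) / \<epsilon>) = 1"
    using assms(1) by (simp add: ramp_eq_0 ramp_eq_1)
  ultimately show ?thesis using 1 by (simp only:)
qed

text \<open>
  Test with a smoothed indicator \<open>\<phi>\<close> of \<open>[s, t]\<close> whose ramps lie outside \<open>[s, t]\<close>: by monotonicity
  \<open>- \<integral> u \<phi>'\<close>, a difference of two averages of \<open>u\<close>, is at least \<open>u t - u s\<close>, while Young's
  inequality \<open>g \<phi> \<le> l g\<^sup>2 / 2 + \<phi>\<^sup>2 / (2 l)\<close> with \<open>l = \<surd>(t - s)\<close> bounds \<open>\<integral> g \<phi>\<close>. Monotonicity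
  makes the estimate hold at every point, although weak derivatives do not see null sets.
\<close>

lemma weak_derivative_increment_le:
  fixes u g :: "real \<Rightarrow> real"
  assumes wd: "weak_derivative_on a b u g"
    and mono: "\<And>x y. a < x \<Longrightarrow> x \<le> y \<Longrightarrow> y < b \<Longrightarrow> u x \<le> u y"
    and K: "(\<integral>\<^sup>+x\<in>{a<..<b}. ennreal ((g x)\<^sup>2) \<partial>lborel) \<le> ennreal K" "0 \<le> K"
    and st: "a < s" "s \<le> t" "t < b"
  shows "u t - u s \<le> (K + 1) / 2 * sqrt (t - s)"
proof (cases "s = t")
  case False
  define l where "l = sqrt (t - s)"
  have l: "0 < l" "l * l = t - s" using False st by (auto simp: l_def)
  \<comment> \<open>the ramps have width \<open>2 * e\<close>, which has to fit between \<open>s\<close>, \<open>t\<close> and the ends of the interval\<close>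
  define e0 where "e0 = min (s - a) (b - t) / 3"
  have e0: "0 < e0" using st by (auto simp: e0_def)
  have est: "u t - u s \<le> l * K / 2 + (t - s + 4 * e) / (2 * l)" if e: "0 < e" "e \<le> e0" for e
  proof -
    have ab: "a < s - 2 * e" "t + 2 * e < b" using e st by (auto simp: e0_def)
    define p1 where "p1 x = tent ((x - (s - e)) / e) / e" for x
    define p2 where "p2 x = tent ((x - (t + e)) / e) / e" for x
    define \<phi> where "\<phi> x = ramp ((x - (s - e)) / e) - ramp ((x - (t + e)) / e)" for x
    define I where "I = {a<..<b}"
    define J where "J = {s - 2 * e..t + 2 * e}"
    have JI: "J \<subseteq> I" using ab by (auto simp: I_def J_def)
    have d: "(\<phi> has_real_derivative p1 x - p2 x) (at x)" for x
      unfolding \<phi>_def[abs_def] p1_def p2_def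
      using e(1) by (intro DERIV_diff DERIV_ramp_affine)
    have cp: "continuous_on A p1" "continuous_on A p2" for A
      unfolding p1_def[abs_def] p2_def[abs_def] using e by (auto intro!: continuous_intros)
    have \<phi>0: "\<phi> x = 0" if "x \<notin> J" for x
    proof (cases "x < s - 2 * e")
      case True
      then show ?thesis unfolding \<phi>_def
        by (subst (1 2) ramp_eq_0) (use e st in \<open>auto simp: field_simps\<close>)
    next
      case False
      then have "t + 2 * e < x" using that by (auto simp: J_def)
      then show ?thesis unfolding \<phi>_def
        by (subst (1 2) ramp_eq_1) (use e st in \<open>auto simp: field_simps\<close>)
    qed
    have \<phi>1: "\<bar>\<phi> x\<bar> \<le> 1" for x
      using ramp_bounds[of "(x - (s - e)) / e"] ramp_bounds[of "(x - (t + e)) / e"]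
      by (auto simp: \<phi>_def)
    have p1_0: "p1 x = 0" if "x \<notin> {s - 2 * e..s}" for x
      using that e by (auto simp: p1_def abs_if field_simps intro!: tent_eq_0)
    have p2_0: "p2 x = 0" if "x \<notin> {t..t + 2 * e}" for x
      using that e by (auto simp: p2_def abs_if field_simps intro!: tent_eq_0)
    have p_nn: "0 \<le> p1 x" "0 \<le> p2 x" for x
      using e tent_nonneg by (auto simp: p1_def p2_def)
    have cont: "continuous_on UNIV \<phi>"
      using d by (meson DERIV_isCont continuous_at_imp_continuous_on)
    have \<phi>_meas: "\<phi> \<in> borel_measurable borel" 
      using cont by (rule borel_measurable_continuous_onI)
    have "(\<forall>c d. a < c \<longrightarrow> d < b \<longrightarrow> set_integrable lborel {c..d} u \<and> set_integrable lborel {c..d} g)"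
      using wd by (simp add: weak_derivative_on_def)
    then have uJ: "set_integrable lborel J u" and gJ: "set_integrable lborel J g"
      using ab by (auto simp: J_def)
    have eq: "(LINT x:I|lborel. u x * (p1 x - p2 x)) = - (LINT x:I|lborel. g x * \<phi> x)"
    proof -
      have "continuous_on I (\<lambda>x. p1 x - p2 x)" using cp by (intro continuous_intros) auto
      moreover have "\<exists>c d. a < c \<and> d < b \<and> (\<forall>x\<in>I. x \<notin> {c..d} \<longrightarrow> \<phi> x = 0)"
        using ab \<phi>0 by (intro exI[of _ "s - 2 * e"] exI[of _ "t + 2 * e"]) (auto simp: J_def)
      ultimately show ?thesis
        using wd[unfolded weak_derivative_on_def, THEN conjunct2, rule_format,
            of \<phi> "\<lambda>x. p1 x - p2 x"] d
        unfolding I_def by simp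
    qed
    have up: "u t - u s \<le> - (LINT x:I|lborel. u x * (p1 x - p2 x))"
    proof -
      have i1: "has_bochner_integral lborel (\<lambda>x. indicator I x * p1 x) 1"
        unfolding p1_def using ab st e by (intro has_bochner_integral_tent) (auto simp: I_def)
      have i2: "has_bochner_integral lborel (\<lambda>x. indicator I x * p2 x) 1"
        unfolding p2_def using ab st e by (intro has_bochner_integral_tent) (auto simp: I_def)
      have i3: "has_bochner_integral lborel
          (\<lambda>x. u s * (indicator I x * p1 x) - u t * (indicator I x * p2 x)) (u s * 1 - u t * 1)"
        by (intro has_bochner_integral_diff has_bochner_integral_mult_right i1 i2)
      have le: "indicator I x *\<^sub>R (u x * (p1 x - p2 x)) \<le>
          u s * (indicator I x * p1 x) - u t * (indicator I x * p2 x)" for x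
      proof (cases "x \<in> I")
        case True
        have "u x * p1 x \<le> u s * p1 x"
          using mono[of x s] True st p1_0[of x] p_nn[of x]
          by (cases "x \<le> s") (auto simp: I_def intro!: mult_right_mono)
        moreover have "u t * p2 x \<le> u x * p2 x"
          using mono[of t x] True st p2_0[of x] p_nn[of x]
          by (cases "t \<le> x") (auto simp: I_def intro!: mult_right_mono)
        ultimately show ?thesis using True by (simp add: algebra_simps)
      qed simp
      have "(LINT x:I|lborel. u x * (p1 x - p2 x)) \<le> u s - u t"
      proof -
        have Jint: "set_integrable lborel J (\<lambda>x. u x * (p1 x - p2 x))"
        proof -
          have c: "compact J" unfolding J_def by simp
          have "continuous_on J (\<lambda>x. p1 x - p2 x)" using cp by (intro continuous_intros) auto
          then have "bounded ((\<lambda>x. p1 x - p2 x) ` J)" using c compact_continuous_image compact_imp_bounded by blast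
          then obtain C where C: "\<bar>p1 x - p2 x\<bar> \<le> C" if "x \<in> J" for x
            by (auto simp: bounded_iff)
          have "integrable lborel (\<lambda>x. indicator J x *\<^sub>R (u x * (p1 x - p2 x)))"
          proof (rule Bochner_Integration.integrable_bound)
            show "integrable lborel (\<lambda>x. C * norm (indicator J x *\<^sub>R u x))"
              using uJ unfolding set_integrable_def by (intro integrable_mult_right integrable_norm)
            have "(\<lambda>x. (indicator J x *\<^sub>R u x) * (p1 x - p2 x)) \<in> borel_measurable lborel"
              using uJ borel_measurable_continuous_onI[OF cp(1)[of UNIV]]
                borel_measurable_continuous_onI[OF cp(2)[of UNIV]]
              unfolding set_integrable_def by (auto intro!: borel_measurable_times borel_measurable_diff)
            then show "(\<lambda>x. indicator J x *\<^sub>R (u x * (p1 x - p2 x))) \<in> borel_measurable lborel"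
              by (simp add: mult.assoc)
            show "AE x in lborel. norm (indicator J x *\<^sub>R (u x * (p1 x - p2 x)))
                \<le> norm (C * norm (indicator J x *\<^sub>R u x))"
            proof (rule AE_I2)
              fix x
              show "norm (indicator J x *\<^sub>R (u x * (p1 x - p2 x)))
                \<le> norm (C * norm (indicator J x *\<^sub>R u x))"
              proof (cases "x \<in> J")
                case True
                then show ?thesis using mult_left_mono[OF C[OF True], of "\<bar>u x\<bar>"] C[OF True]
                  by (simp add: abs_mult mult.commute)
              qed simp
            qed
          qed
          then show ?thesis by (simp add: set_integrable_def)
        qed
        have int: "integrable lborel (\<lambda>x. indicator I x *\<^sub>R (u x * (p1 x - p2 x)))"
        proof -
          have "indicator J x *\<^sub>R (u x * (p1 x - p2 x)) = indicator I x *\<^sub>R (u x * (p1 x - p2 x))" for x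
            using JI p1_0[of x] p2_0[of x] e st
            by (cases "x \<in> J") (auto simp: J_def indicator_def)
          from Jint[unfolded set_integrable_def this] show ?thesis .
        qed
        have "(LINT x:I|lborel. u x * (p1 x - p2 x)) \<le>
            (LINT x|lborel. u s * (indicator I x * p1 x) - u t * (indicator I x * p2 x))"
          unfolding set_lebesgue_integral_def
          by (rule integral_mono[OF int _ le]) (use i3 in \<open>rule integrable.intros\<close>)
        also have "\<dots> = u s - u t"
          using has_bochner_integral_integral_eq[OF i3] by simp
        finally show ?thesis .
      qed
      then show ?thesis by simp
    qed
    have gb: "(LINT x:I|lborel. g x * \<phi> x) \<le> l * K / 2 + (t - s + 4 * e) / (2 * l)"
    proof -
      have gm: "(\<lambda>x. indicator J x * g x) \<in> borel_measurable lborel"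
        using gJ by (auto simp: set_integrable_def)
      have g2: "(\<integral>\<^sup>+x. ennreal ((indicator J x * g x)\<^sup>2) \<partial>lborel) \<le> ennreal K"
      proof -
        have "(\<integral>\<^sup>+x. ennreal ((indicator J x * g x)\<^sup>2) \<partial>lborel) \<le>
            (\<integral>\<^sup>+x\<in>I. ennreal ((g x)\<^sup>2) \<partial>lborel)"
          using JI by (intro nn_integral_mono) (auto simp: indicator_def)
        then show ?thesis using K(1) unfolding I_def by (rule order_trans)
      qed
      have g2i: "integrable lborel (\<lambda>x. (indicator J x * g x)\<^sup>2)"
        using gm g2 by (intro integrableI_nonneg) (auto simp: le_less_trans ennreal_less_top)
      have g2K: "(LINT x|lborel. (indicator J x * g x)\<^sup>2) \<le> K"
        using g2 K(2) nn_integral_eq_integral[OF g2i] by simp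
      have i1: "integrable lborel (indicator J :: real \<Rightarrow> real)"
        by (auto simp: J_def integrable_indicator_iff emeasure_lborel_Icc_eq)
      have J1: "(LINT x|lborel. indicator J x) = t - s + 4 * e"
        using e st by (simp add: J_def)
      have bd: "indicator I x *\<^sub>R (g x * \<phi> x) \<le>
          l / 2 * (indicator J x * g x)\<^sup>2 + 1 / (2 * l) * indicator J x" for x
      proof (cases "x \<in> J")
        case True
        have "g x * \<phi> x \<le> \<bar>g x\<bar> * 1"
          using \<phi>1[of x] by (metis abs_ge_self abs_mult abs_ge_zero mult_left_mono order_trans)
        also have "\<dots> \<le> l / 2 * (g x)\<^sup>2 + 1 / (2 * l)"
        proof -
          have "0 \<le> (l * \<bar>g x\<bar> - 1)\<^sup>2" by simp
          then have "2 * l * \<bar>g x\<bar> \<le> l\<^sup>2 * (g x)\<^sup>2 + 1"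
            by (simp add: power2_diff power_mult_distrib)
          then show ?thesis using l(1) by (simp add: field_simps power2_eq_square)
        qed
        finally show ?thesis using True JI by auto
      next
        case False
        then show ?thesis using \<phi>0[OF False] by simp
      qed
      have "(LINT x:I|lborel. g x * \<phi> x) \<le>
          (LINT x|lborel. l / 2 * (indicator J x * g x)\<^sup>2 + 1 / (2 * l) * indicator J x)"
        unfolding set_lebesgue_integral_def
      proof (rule integral_mono[OF _ _ bd])
        have i: "integrable lborel (\<lambda>x. \<phi> x * (indicator J x * g x))"
        proof (rule Bochner_Integration.integrable_bound)
          show "integrable lborel (\<lambda>x. indicator J x * g x)"
            using gJ by (simp add: set_integrable_def)
          show "(\<lambda>x. \<phi> x * (indicator J x * g x)) \<in> borel_measurable lborel"
            using \<phi>_meas gm by simp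
          show "AE x in lborel. norm (\<phi> x * (indicator J x * g x)) \<le> norm (indicator J x * g x)"
            using \<phi>1 by (intro AE_I2) (simp add: abs_mult mult_left_le_one_le)
        qed
        have "\<phi> x * (indicator J x * g x) = indicator I x *\<^sub>R (g x * \<phi> x)" for x
          using JI \<phi>0[of x] by (cases "x \<in> J") auto
        with i show "integrable lborel (\<lambda>x. indicator I x *\<^sub>R (g x * \<phi> x))" by simp
      qed (use g2i i1 in simp)
      also have "\<dots> = l / 2 * (LINT x|lborel. (indicator J x * g x)\<^sup>2) + 1 / (2 * l) * (t - s + 4 * e)"
        using g2i i1 J1 by simp
      also have "\<dots> \<le> l / 2 * K + 1 / (2 * l) * (t - s + 4 * e)"
        using g2K l(1) by (intro add_right_mono mult_left_mono) auto
      finally show ?thesis by simp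
    qed
    show ?thesis using up eq gb by linarith
  qed
  have "u t - u s \<le> l * K / 2 + (t - s) / (2 * l) + y" if "0 < y" for y
  proof -
    define e where "e = min e0 (y * l / 2)"
    have e: "0 < e" "e \<le> e0" "e \<le> y * l / 2" using e0 that l by (auto simp: e_def)
    have "(t - s + 4 * e) / (2 * l) = (t - s) / (2 * l) + 2 * e / l"
      using l by (simp add: field_simps)
    moreover have "2 * e / l \<le> y" using e l by (simp add: field_simps)
    ultimately show ?thesis using est[OF e(1,2)] by linarith
  qed
  then have "u t - u s \<le> l * K / 2 + (t - s) / (2 * l)"
    by (rule field_le_epsilon)
  also have "(t - s) / (2 * l) = l / 2"
    using l by (simp add: field_simps)
  finally show ?thesis by (simp add: l_def field_simps)
qed simp

section \<open>The maximal drop of Brownian motion\<close>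

text \<open>
  The layer-cake formula: the integral of a nonnegative function is the integral of its tail.
  The strict inequality on one side lets \<open>X\<close> be a supremum that is not attained.
\<close>

lemma (in sigma_finite_measure) nn_integral_le_of_tail:
  fixes X Z :: "'a \<Rightarrow> real"
  assumes [measurable]: "X \<in> borel_measurable M" "Z \<in> borel_measurable M"
    and tail: "\<And>y. 0 < y \<Longrightarrow>
      emeasure M {\<omega>\<in>space M. y < X \<omega>} \<le> c * emeasure M {\<omega>\<in>space M. y \<le> Z \<omega>}"
  shows "(\<integral>\<^sup>+\<omega>. ennreal (X \<omega>) \<partial>M) \<le> c * (\<integral>\<^sup>+\<omega>. ennreal (Z \<omega>) \<partial>M)"
proof -
  interpret P: pair_sigma_finite M lborel ..
  define I where "I x y = (if 0 < y \<and> y < x then 1 else 0 :: ennreal)" for x y :: real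
  define J where "J x y = (if 0 < y \<and> y \<le> x then 1 else 0 :: ennreal)" for x y :: real
  have X: "ennreal (X \<omega>) = (\<integral>\<^sup>+y. I (X \<omega>) y \<partial>lborel)" for \<omega>
  proof -
    have "(\<integral>\<^sup>+y. I (X \<omega>) y \<partial>lborel) = (\<integral>\<^sup>+y. indicator {0<..<X \<omega>} y \<partial>lborel)"
      by (intro nn_integral_cong) (auto simp: I_def)
    then show ?thesis by (cases "0 \<le> X \<omega>") (auto simp: ennreal_neg)
  qed
  have Z: "ennreal (Z \<omega>) = (\<integral>\<^sup>+y. J (Z \<omega>) y \<partial>lborel)" for \<omega>
  proof -
    have "(\<integral>\<^sup>+y. J (Z \<omega>) y \<partial>lborel) = (\<integral>\<^sup>+y. indicator {0<..Z \<omega>} y \<partial>lborel)"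
      by (intro nn_integral_cong) (auto simp: J_def)
    then show ?thesis by (cases "0 \<le> Z \<omega>") (auto simp: ennreal_neg)
  qed
  have meas [measurable]: "(\<lambda>(\<omega>, y). I (X \<omega>) y) \<in> borel_measurable (M \<Otimes>\<^sub>M lborel)"
    "(\<lambda>(\<omega>, y). J (Z \<omega>) y) \<in> borel_measurable (M \<Otimes>\<^sub>M lborel)"
    unfolding I_def J_def by measurable
  have "(\<integral>\<^sup>+\<omega>. ennreal (X \<omega>) \<partial>M) = (\<integral>\<^sup>+y. (\<integral>\<^sup>+\<omega>. I (X \<omega>) y \<partial>M) \<partial>lborel)"
    unfolding X by (rule P.Fubini'[symmetric]) (rule meas)
  also have "\<dots> \<le> (\<integral>\<^sup>+y. c * (\<integral>\<^sup>+\<omega>. J (Z \<omega>) y \<partial>M) \<partial>lborel)"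
  proof (rule nn_integral_mono)
    fix y :: real
    show "(\<integral>\<^sup>+\<omega>. I (X \<omega>) y \<partial>M) \<le> c * (\<integral>\<^sup>+\<omega>. J (Z \<omega>) y \<partial>M)"
    proof (cases "0 < y")
      case True
      have "(\<integral>\<^sup>+\<omega>. I (X \<omega>) y \<partial>M) = (\<integral>\<^sup>+\<omega>. indicator {\<omega>\<in>space M. y < X \<omega>} \<omega> \<partial>M)"
        using True by (intro nn_integral_cong) (auto simp: I_def)
      also have "\<dots> = emeasure M {\<omega>\<in>space M. y < X \<omega>}" by simp
      also have "\<dots> \<le> c * emeasure M {\<omega>\<in>space M. y \<le> Z \<omega>}" by (rule tail[OF True])
      also have "emeasure M {\<omega>\<in>space M. y \<le> Z \<omega>} =
          (\<integral>\<^sup>+\<omega>. indicator {\<omega>\<in>space M. y \<le> Z \<omega>} \<omega> \<partial>M)" by simp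
      also have "\<dots> = (\<integral>\<^sup>+\<omega>. J (Z \<omega>) y \<partial>M)"
        using True by (intro nn_integral_cong) (auto simp: J_def)
      finally show ?thesis .
    qed (auto simp: I_def)
  qed
  also have "\<dots> = c * (\<integral>\<^sup>+y. (\<integral>\<^sup>+\<omega>. J (Z \<omega>) y \<partial>M) \<partial>lborel)"
    by (rule nn_integral_cmult) measurable
  also have "\<dots> = c * (\<integral>\<^sup>+\<omega>. ennreal (Z \<omega>) \<partial>M)"
    unfolding Z by (subst P.Fubini'[OF meas(2)]) simp
  finally show ?thesis .
qed

lemma distributed_uminus_normal:
  assumes "prob_space M" "0 < \<sigma>" "distributed M lborel X (\<lambda>x. ennreal (normal_density 0 \<sigma> x))"
  shows "distributed M lborel (\<lambda>\<omega>. - X \<omega>) (\<lambda>x. ennreal (normal_density 0 \<sigma> x))"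
  using prob_space.normal_density_affine[OF assms(1,3,2), of "-1" 0] by simp

text \<open>
  The factor \<open>2\<close> of Levy's inequality is compensated by symmetry, which is what makes the bound
  for the expected maximal drop sharp.
\<close>

lemma nn_integral_pos_part_normal:
  assumes "prob_space M" "0 < \<sigma>" "distributed M lborel X (\<lambda>x. ennreal (normal_density 0 \<sigma> x))"
    and "0 < p"
  shows "2 * (\<integral>\<^sup>+\<omega>. ennreal (max 0 (X \<omega>) ^ p) \<partial>M) =
    (\<integral>\<^sup>+x. ennreal (normal_density 0 \<sigma> x * \<bar>x\<bar> ^ p) \<partial>lborel)"
proof -
  have [measurable]: "X \<in> borel_measurable M"
    using distributed_measurable[OF assms(3)] by simp
  have "(\<integral>\<^sup>+\<omega>. ennreal (max 0 (- X \<omega>) ^ p) \<partial>M) =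
      (\<integral>\<^sup>+\<omega>. ennreal (max 0 (X \<omega>) ^ p) \<partial>M)"
    using distributed_nn_integral[OF distributed_uminus_normal[OF assms(1-3)], of "\<lambda>x. ennreal (max 0 x ^ p)"]
      distributed_nn_integral[OF assms(3), of "\<lambda>x. ennreal (max 0 x ^ p)"] by simp
  then have "2 * (\<integral>\<^sup>+\<omega>. ennreal (max 0 (X \<omega>) ^ p) \<partial>M) =
      (\<integral>\<^sup>+\<omega>. ennreal (max 0 (X \<omega>) ^ p) \<partial>M) + (\<integral>\<^sup>+\<omega>. ennreal (max 0 (- X \<omega>) ^ p) \<partial>M)"
    by (simp add: mult_2)
  also have "\<dots> = (\<integral>\<^sup>+\<omega>. ennreal (max 0 (X \<omega>) ^ p) + ennreal (max 0 (- X \<omega>) ^ p) \<partial>M)"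
    by (rule nn_integral_add[symmetric]) simp_all
  also have "\<dots> = (\<integral>\<^sup>+\<omega>. ennreal (\<bar>X \<omega>\<bar> ^ p) \<partial>M)"
    using \<open>0 < p\<close> by (intro nn_integral_cong) (auto simp: max_def abs_if zero_power)
  also have "\<dots> = (\<integral>\<^sup>+x. ennreal (normal_density 0 \<sigma> x) * ennreal (\<bar>x\<bar> ^ p) \<partial>lborel)"
    using distributed_nn_integral[OF assms(3), of "\<lambda>x. ennreal (\<bar>x\<bar> ^ p)"] by simp
  finally show ?thesis by (simp add: ennreal_mult)
qed

text \<open>
  The largest drop below the value at \<open>a\<close>. Rational times make it measurable without any
  assumption on the paths, and for continuous paths they give the true, finite supremum. If the
  supremum is infinite, the value is the default \<open>0\<close>.
\<close>

definition max_drop :: "(real \<Rightarrow> 'a \<Rightarrow> real) \<Rightarrow> real \<Rightarrow> real \<Rightarrow> 'a \<Rightarrow> real" where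
  "max_drop W a b \<omega> = enn2real (SUP s\<in>{a<..<b} \<inter> \<rat>. ennreal (W a \<omega> - W s \<omega>))"

lemma max_drop_nonneg: "0 \<le> max_drop W a b \<omega>"
  by (simp add: max_drop_def)

lemma measurable_max_drop:
  assumes "\<And>t. a \<le> t \<Longrightarrow> W t \<in> borel_measurable N"
  shows "max_drop W a b \<in> borel_measurable N"
proof -
  have "(\<lambda>\<omega>. SUP s\<in>{a<..<b} \<inter> \<rat>. ennreal (W a \<omega> - W s \<omega>)) \<in> borel_measurable N"
  proof (rule borel_measurable_SUP)
    show "countable ({a<..<b} \<inter> \<rat>)" by (simp add: countable_Int2 countable_rat)
    fix s assume "s \<in> {a<..<b} \<inter> \<rat>"
    then have [measurable]: "W s \<in> borel_measurable N" "W a \<in> borel_measurable N"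
      using assms by auto
    show "(\<lambda>\<omega>. ennreal (W a \<omega> - W s \<omega>)) \<in> borel_measurable N" by measurable
  qed
  then show ?thesis unfolding max_drop_def[abs_def] by measurable
qed

lemma drop_le_max_drop:
  assumes cont: "continuous_on {a..b} (\<lambda>t. W t \<omega>)" and s: "s \<in> {a..b}" and ab: "a < b"
  shows "W a \<omega> - W s \<omega> \<le> max_drop W a b \<omega>"
proof -
  define Q where "Q = {a<..<b} \<inter> \<rat>"
  have cl: "closure Q = {a..b}"
    unfolding Q_def using ab
    by (subst closure_open_Int_superset) (auto simp: Rats_closure_real)
  have cont': "continuous_on (closure Q) (\<lambda>s. W a \<omega> - W s \<omega>)"
    unfolding cl using cont by (intro continuous_intros)
  have "bounded ((\<lambda>s. W a \<omega> - W s \<omega>) ` {a..b})"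
    using cont' cl by (intro compact_imp_bounded compact_continuous_image) auto
  then obtain C where C: "\<forall>s\<in>{a..b}. \<bar>W a \<omega> - W s \<omega>\<bar> \<le> C"
    by (auto simp: bounded_iff)
  have "(SUP s\<in>Q. ennreal (W a \<omega> - W s \<omega>)) \<le> ennreal C"
  proof (intro SUP_least ennreal_leI)
    fix s assume "s \<in> Q"
    then have "\<bar>W a \<omega> - W s \<omega>\<bar> \<le> C" using C by (auto simp: Q_def)
    then show "W a \<omega> - W s \<omega> \<le> C" by simp
  qed
  then have fin: "(SUP s\<in>Q. ennreal (W a \<omega> - W s \<omega>)) < top"
    using ennreal_less_top le_less_trans by blast
  have Q: "W a \<omega> - W s \<omega> \<le> max_drop W a b \<omega>" if "s \<in> Q" for s
  proof -
    have "ennreal (W a \<omega> - W s \<omega>) \<le> (SUP s\<in>Q. ennreal (W a \<omega> - W s \<omega>))"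
      using that by (rule SUP_upper)
    also have "\<dots> = ennreal (max_drop W a b \<omega>)"
      using fin by (simp add: max_drop_def Q_def)
    finally show ?thesis
      using ennreal_le_iff[OF max_drop_nonneg[of W a b \<omega>]] by blast
  qed
  show ?thesis
    using continuous_le_on_closure[OF cont' _ Q] s cl by simp
qed

context
  fixes M :: "'a measure" and F W
  assumes bm: "standard_brownian_motion M F W"
begin

lemma brownian_prob_space: "prob_space M"
  using bm by (simp add: standard_brownian_motion_def)

lemma brownian_adapted: "0 \<le> s \<Longrightarrow> s \<le> t \<Longrightarrow> W s \<in> borel_measurable (F t)"
  using bm measurable_from_subalg[of "F t" "F s" "W s" borel]
  by (auto simp: standard_brownian_motion_def filtration_nonneg_def)

lemma brownian_sets_mono: "0 \<le> t \<Longrightarrow> A \<in> sets (F t) \<Longrightarrow> A \<in> sets M"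
  using bm by (auto simp: standard_brownian_motion_def filtration_nonneg_def subalgebra_def)

lemma brownian_space: "0 \<le> t \<Longrightarrow> space (F t) = space M"
  using bm by (auto simp: standard_brownian_motion_def filtration_nonneg_def subalgebra_def)

lemma brownian_measurable: "0 \<le> t \<Longrightarrow> W t \<in> borel_measurable M"
  using bm brownian_adapted[of t t] measurable_from_subalg[of M "F t" "W t" borel]
  by (auto simp: standard_brownian_motion_def filtration_nonneg_def)

lemma brownian_drop_distributed:
  assumes "0 \<le> s" "s < t"
  shows "distributed M lborel (\<lambda>\<omega>. W s \<omega> - W t \<omega>) (\<lambda>x. ennreal (normal_density 0 (sqrt (t - s)) x))"
  using distributed_uminus_normal[OF brownian_prob_space, of "sqrt (t - s)" "\<lambda>\<omega>. W t \<omega> - W s \<omega>"]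
    bm assms by (auto simp: standard_brownian_motion_def)

lemma brownian_drop_indep:
  assumes "0 \<le> s" "s < t" "A \<in> sets (F s)" "C \<in> sets borel"
  shows "measure M (A \<inter> {\<omega>\<in>space M. W s \<omega> - W t \<omega> \<in> C}) =
    measure M A * measure M {\<omega>\<in>space M. W s \<omega> - W t \<omega> \<in> C}"
proof (rule prob_space.indep_setD[OF brownian_prob_space])
  show "prob_space.indep_set M (sets (F s))
          (sets (vimage_algebra (space M) (\<lambda>\<omega>. W t \<omega> - W s \<omega>) borel))"
    using bm assms by (auto simp: standard_brownian_motion_def)
  have "uminus -` C \<in> sets borel"
    using assms(4) measurable_sets[of uminus borel borel C] by simp
  from in_vimage_algebra[OF this, of "\<lambda>\<omega>. W t \<omega> - W s \<omega>" "space M"]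
  show "{\<omega>\<in>space M. W s \<omega> - W t \<omega> \<in> C} \<in> sets (vimage_algebra (space M) (\<lambda>\<omega>. W t \<omega> - W s \<omega>) borel)"
    by (simp add: vimage_def Int_def conj_commute)
qed fact

lemma brownian_drop_nonneg_prob:
  assumes "0 \<le> s" "s \<le> t"
  shows "1 / 2 \<le> measure M {\<omega>\<in>space M. 0 \<le> W s \<omega> - W t \<omega>}"
proof (cases "s = t")
  case True
  then show ?thesis using prob_space.prob_space[OF brownian_prob_space] by simp
next
  case False
  interpret prob_space M by (rule brownian_prob_space)
  have st: "s < t" using assms False by simp
  note [measurable] = brownian_measurable[of s] brownian_measurable[of t]
  have 0: "0 \<le> t" "0 \<le> s" using assms by auto
  note d = brownian_drop_distributed[OF assms(1) st]
  note d' = distributed_uminus_normal[OF brownian_prob_space _ d]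
  have "emeasure M ((\<lambda>\<omega>. W s \<omega> - W t \<omega>) -` {0..} \<inter> space M) =
      emeasure M ((\<lambda>\<omega>. - (W s \<omega> - W t \<omega>)) -` {0..} \<inter> space M)"
    using distributed_emeasure[OF d, of "{0..}"] distributed_emeasure[OF d', of "{0..}"] st by simp
  then have "measure M {\<omega>\<in>space M. 0 \<le> W s \<omega> - W t \<omega>} = measure M {\<omega>\<in>space M. W s \<omega> - W t \<omega> \<le> 0}"
    by (simp add: measure_def vimage_def Int_def conj_commute)
  moreover have "1 \<le> measure M {\<omega>\<in>space M. 0 \<le> W s \<omega> - W t \<omega>} + measure M {\<omega>\<in>space M. W s \<omega> - W t \<omega> \<le> 0}"
  proof -
    have "{\<omega>\<in>space M. 0 \<le> W s \<omega> - W t \<omega>} \<union> {\<omega>\<in>space M. W s \<omega> - W t \<omega> \<le> 0} = space M" by auto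
    then show ?thesis
      using measure_Un_le[of "{\<omega>\<in>space M. 0 \<le> W s \<omega> - W t \<omega>}" M "{\<omega>\<in>space M. W s \<omega> - W t \<omega> \<le> 0}"]
      by (simp add: prob_space 0)
  qed
  ultimately show ?thesis by simp
qed

text \<open>
  At the first time \<open>s\<close> in \<open>S\<close> at which the drop reaches \<open>x\<close>, the future \<open>W s - W b\<close> is symmetric and
  independent of the past, so with probability at least \<open>1 / 2\<close> the drop is still at least \<open>x\<close> at
  time \<open>b\<close>.
\<close>

lemma levy_maximal_inequality:
  assumes ab: "0 \<le> a" "a \<le> b" and S: "finite S" "S \<subseteq> {a..b}"
  shows "measure M {\<omega>\<in>space M. \<exists>s\<in>S. x \<le> W a \<omega> - W s \<omega>} \<le>
    2 * measure M {\<omega>\<in>space M. x \<le> W a \<omega> - W b \<omega>}"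
proof -
  interpret prob_space M by (rule brownian_prob_space)
  \<comment> \<open>the event that \<open>s\<close> is the first such time, and the event that the path does not recover after \<open>s\<close>\<close>
  define A where "A s = {\<omega>\<in>space M. x \<le> W a \<omega> - W s \<omega> \<and> (\<forall>r\<in>S. r < s \<longrightarrow> W a \<omega> - W r \<omega> < x)}" for s
  define H where "H s = {\<omega>\<in>space M. W s \<omega> - W b \<omega> \<in> {0..}}" for s
  have AF: "A s \<in> sets (F s)" if "s \<in> S" for s
  proof -
    have s: "a \<le> s" "s \<le> b" "0 \<le> s" using that S ab by auto
    have [measurable]: "W a \<in> borel_measurable (F s)" "W s \<in> borel_measurable (F s)"
      using s ab by (auto intro: brownian_adapted)
    have "{\<omega>\<in>space (F s). x \<le> W a \<omega> - W s \<omega> \<and> (\<forall>r\<in>{r\<in>S. r < s}. W a \<omega> - W r \<omega> < x)} \<in> sets (F s)"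
    proof (intro sets.sets_Collect_conj sets.sets_Collect_finite_All)
      fix r assume "r \<in> {r \<in> S. r < s}"
      then have "a \<le> r" "r < s" using S by auto
      then have [measurable]: "W r \<in> borel_measurable (F s)"
        using ab by (auto intro: brownian_adapted)
      show "{\<omega> \<in> space (F s). W a \<omega> - W r \<omega> < x} \<in> sets (F s)" by measurable
    qed (use S in \<open>simp_all\<close>)
    also have "{\<omega>\<in>space (F s). x \<le> W a \<omega> - W s \<omega> \<and> (\<forall>r\<in>{r\<in>S. r < s}. W a \<omega> - W r \<omega> < x)} = A s"
      by (auto simp: A_def brownian_space[OF s(3)])
    finally show ?thesis .
  qed
  have AM: "A s \<in> sets M" if "s \<in> S" for s
    using AF[OF that] that S ab by (intro brownian_sets_mono[of s]) auto
  have HM: "H s \<in> sets M" if "s \<in> S" for s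
  proof -
    have [measurable]: "W s \<in> borel_measurable M" "W b \<in> borel_measurable M"
      using that S ab by (auto intro!: brownian_measurable)
    show ?thesis unfolding H_def by measurable
  qed
  have half: "measure M (A s) \<le> 2 * measure M (A s \<inter> H s)" if "s \<in> S" for s
  proof (cases "s = b")
    case True
    then have "A s \<inter> H s = A s" by (auto simp: A_def H_def)
    then show ?thesis by simp
  next
    case False
    then have s: "0 \<le> s" "s < b" using that S ab by auto
    have "measure M (A s \<inter> H s) = measure M (A s) * measure M (H s)"
      unfolding H_def by (rule brownian_drop_indep[OF s AF[OF that]]) simp
    moreover have "measure M (A s) * (1 / 2) \<le> measure M (A s) * measure M (H s)"
      using brownian_drop_nonneg_prob[of s b] s by (intro mult_left_mono) (auto simp: H_def)
    ultimately show ?thesis by simp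
  qed
  have disj: "disjoint_family_on A S"
    unfolding disjoint_family_on_def
  proof (intro ballI impI)
    fix m n assume "m \<in> S" "n \<in> S" "m \<noteq> n"
    then show "A m \<inter> A n = {}" by (cases m n rule: linorder_cases) (force simp: A_def)+
  qed
  then have disjH: "disjoint_family_on (\<lambda>s. A s \<inter> H s) S"
    by (auto simp: disjoint_family_on_def)
  have "{\<omega>\<in>space M. \<exists>s\<in>S. x \<le> W a \<omega> - W s \<omega>} = (\<Union>s\<in>S. A s)"
  proof (intro equalityI subsetI)
    fix \<omega> assume w: "\<omega> \<in> {\<omega>\<in>space M. \<exists>s\<in>S. x \<le> W a \<omega> - W s \<omega>}"
    define Q where "Q = {s\<in>S. x \<le> W a \<omega> - W s \<omega>}"
    have Q: "finite Q" "Q \<noteq> {}" using w S by (auto simp: Q_def)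
    have "Min Q \<in> Q" using Q by (rule Min_in)
    moreover have "W a \<omega> - W r \<omega> < x" if "r \<in> S" "r < Min Q" for r
      using that Min_le[OF Q(1), of r] by (force simp: Q_def)
    ultimately have "\<omega> \<in> A (Min Q)" "Min Q \<in> S" using w by (auto simp: A_def Q_def)
    then show "\<omega> \<in> (\<Union>s\<in>S. A s)" by blast
  qed (auto simp: A_def)
  then have "measure M {\<omega>\<in>space M. \<exists>s\<in>S. x \<le> W a \<omega> - W s \<omega>} = (\<Sum>s\<in>S. measure M (A s))"
    using finite_measure_finite_Union[OF S(1) _ disj] AM by auto
  also have "\<dots> \<le> (\<Sum>s\<in>S. 2 * measure M (A s \<inter> H s))"
    by (rule sum_mono) (rule half)
  also have "\<dots> = 2 * measure M (\<Union>s\<in>S. A s \<inter> H s)"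
  proof -
    have "measure M (\<Union>s\<in>S. A s \<inter> H s) = (\<Sum>s\<in>S. measure M (A s \<inter> H s))"
      by (rule finite_measure_finite_Union[OF S(1) _ disjH]) (use AM HM in auto)
    then show ?thesis by (simp add: sum_distrib_left)
  qed
  also have "\<dots> \<le> 2 * measure M {\<omega>\<in>space M. x \<le> W a \<omega> - W b \<omega>}"
  proof -
    have [measurable]: "W a \<in> borel_measurable M" "W b \<in> borel_measurable M"
      using ab by (auto intro!: brownian_measurable)
    show ?thesis
      by (intro mult_left_mono finite_measure_mono) (auto simp: A_def H_def)
  qed
  finally show ?thesis .
qed

lemma levy_maximal_inequality_countable:
  assumes ab: "0 \<le> a" "a \<le> b" and S: "countable S" "S \<subseteq> {a..b}"
  shows "measure M {\<omega>\<in>space M. \<exists>s\<in>S. x \<le> W a \<omega> - W s \<omega>} \<le>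
    2 * measure M {\<omega>\<in>space M. x \<le> W a \<omega> - W b \<omega>}"
proof (cases "S = {}")
  case False
  interpret prob_space M by (rule brownian_prob_space)
  define A where "A n = {\<omega>\<in>space M. \<exists>s\<in>from_nat_into S ` {..n}. x \<le> W a \<omega> - W s \<omega>}" for n :: nat
  have sub: "from_nat_into S ` {..n} \<subseteq> S" for n
    using from_nat_into[OF False] by auto
  have "A n \<in> sets M" for n
    unfolding A_def
  proof (rule sets.sets_Collect_finite_Ex)
    fix s assume "s \<in> from_nat_into S ` {..n}"
    then have "s \<in> S" using sub[of n] by blast
    then have "a \<le> s" using S by auto
    then have [measurable]: "W s \<in> borel_measurable M" "W a \<in> borel_measurable M"
      using ab by (auto intro!: brownian_measurable)
    show "{\<omega> \<in> space M. x \<le> W a \<omega> - W s \<omega>} \<in> sets M" by measurable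
  qed simp
  moreover have "incseq A" 
    unfolding A_def by (auto simp: incseq_def intro: order_trans)
  ultimately have "(\<lambda>n. measure M (A n)) \<longlonglongrightarrow> measure M (\<Union>n. A n)"
    by (intro finite_Lim_measure_incseq) auto
  moreover have "(\<Union>n. A n) = {\<omega>\<in>space M. \<exists>s\<in>S. x \<le> W a \<omega> - W s \<omega>}"
  proof (intro equalityI subsetI)
    fix \<omega> assume "\<omega> \<in> {\<omega>\<in>space M. \<exists>s\<in>S. x \<le> W a \<omega> - W s \<omega>}"
    then obtain s where s: "s \<in> S" "x \<le> W a \<omega> - W s \<omega>" "\<omega> \<in> space M" by auto
    then have "\<omega> \<in> A (to_nat_on S s)"
      using S(1) by (auto simp: A_def intro!: bexI[of _ "to_nat_on S s"])
    then show "\<omega> \<in> (\<Union>n. A n)" by blast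
  qed (use sub in \<open>fastforce simp: A_def\<close>)
  ultimately have "(\<lambda>n. measure M (A n)) \<longlonglongrightarrow> measure M {\<omega>\<in>space M. \<exists>s\<in>S. x \<le> W a \<omega> - W s \<omega>}"
    by simp
  then show ?thesis
  proof (rule LIMSEQ_le_const2)
    show "\<exists>N. \<forall>n\<ge>N. measure M (A n) \<le> 2 * measure M {\<omega>\<in>space M. x \<le> W a \<omega> - W b \<omega>}"
      unfolding A_def using sub S(2)
      by (intro exI[of _ 0] allI impI levy_maximal_inequality[OF ab]) (auto dest: subsetD)
  qed
qed simp

text \<open>
  The maximal drop and the terminal one compare through their tails, hence through all moments.
\<close>

lemma nn_integral_max_drop_power_le:
  assumes ab: "0 \<le> a" "a < b" and p: "0 < p"
  shows "(\<integral>\<^sup>+\<omega>. ennreal (max_drop W a b \<omega> ^ p) \<partial>M) \<le>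
    (\<integral>\<^sup>+x. ennreal (normal_density 0 (sqrt (b - a)) x * \<bar>x\<bar> ^ p) \<partial>lborel)"
proof -
  interpret prob_space M by (rule brownian_prob_space)
  have [measurable]: "max_drop W a b \<in> borel_measurable M" 
    "W a \<in> borel_measurable M" "W b \<in> borel_measurable M"
    using ab by (auto intro!: measurable_max_drop brownian_measurable)
  have "(\<integral>\<^sup>+\<omega>. ennreal (max_drop W a b \<omega> ^ p) \<partial>M) \<le>
      2 * (\<integral>\<^sup>+\<omega>. ennreal (max 0 (W a \<omega> - W b \<omega>) ^ p) \<partial>M)"
  proof (rule nn_integral_le_of_tail)
    fix y :: real assume y: "0 < y"
    define r where "r = root p y"
    have r: "0 < r" "r ^ p = y" using y p by (auto simp: r_def)
    have QM: "{\<omega>\<in>space M. \<exists>s\<in>{a<..<b} \<inter> \<rat>. r \<le> W a \<omega> - W s \<omega>} \<in> sets M"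
    proof (rule sets.sets_Collect_countable_Ex')
      fix s assume "s \<in> {a<..<b} \<inter> \<rat>"
      then have [measurable]: "W s \<in> borel_measurable M"
        using ab by (auto intro!: brownian_measurable)
      show "{\<omega>\<in>space M. r \<le> W a \<omega> - W s \<omega>} \<in> sets M" by measurable
    qed (simp add: countable_Int2 countable_rat)
    have "measure M {\<omega>\<in>space M. y < max_drop W a b \<omega> ^ p} \<le>
        measure M {\<omega>\<in>space M. \<exists>s\<in>{a<..<b} \<inter> \<rat>. r \<le> W a \<omega> - W s \<omega>}"
    proof (rule finite_measure_mono[OF _ QM], safe)
      fix \<omega> assume "y < max_drop W a b \<omega> ^ p"
      then have "r < max_drop W a b \<omega>"
        using power_less_imp_less_base[of r p "max_drop W a b \<omega>"] r max_drop_nonneg[of W a b \<omega>] by simp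
      then have "ennreal r < (SUP s\<in>{a<..<b} \<inter> \<rat>. ennreal (W a \<omega> - W s \<omega>))"
        unfolding max_drop_def using r(1)
        by (metis ennreal_enn2real_if ennreal_less_iff ennreal_less_top infinity_ennreal_def
            less_eq_real_def)
      then obtain s where "s \<in> {a<..<b} \<inter> \<rat>" "ennreal r < ennreal (W a \<omega> - W s \<omega>)"
        by (auto simp: less_SUP_iff)
      then show "\<exists>s\<in>{a<..<b} \<inter> \<rat>. r \<le> W a \<omega> - W s \<omega>"
        using r(1) by (intro bexI[of _ s]) (auto simp: ennreal_less_iff)
    qed
    also have "\<dots> \<le> 2 * measure M {\<omega>\<in>space M. r \<le> W a \<omega> - W b \<omega>}"
      using ab by (intro levy_maximal_inequality_countable) (auto simp: countable_Int2 countable_rat)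
    also have "\<dots> \<le> 2 * measure M {\<omega>\<in>space M. y \<le> max 0 (W a \<omega> - W b \<omega>) ^ p}"
      using r by (intro mult_left_mono finite_measure_mono) (auto intro!: power_mono)
    finally show "emeasure M {\<omega>\<in>space M. y < max_drop W a b \<omega> ^ p} \<le>
        2 * emeasure M {\<omega>\<in>space M. y \<le> max 0 (W a \<omega> - W b \<omega>) ^ p}"
      by (simp add: emeasure_eq_measure ennreal_mult[symmetric] flip: ennreal_numeral)
  qed measurable
  also have "\<dots> = (\<integral>\<^sup>+x. ennreal (normal_density 0 (sqrt (b - a)) x * \<bar>x\<bar> ^ p) \<partial>lborel)"
    using ab p
    by (intro nn_integral_pos_part_normal brownian_prob_space brownian_drop_distributed) auto
  finally show ?thesis .
qed

lemma
  assumes ab: "0 \<le> a" "a < b" and p: "0 < p"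
  shows integrable_max_drop_power: "integrable M (\<lambda>\<omega>. max_drop W a b \<omega> ^ p)"
    and integral_max_drop_power_le: "(LINT \<omega>|M. max_drop W a b \<omega> ^ p) \<le>
      (LINT x|lborel. normal_density 0 (sqrt (b - a)) x * \<bar>x\<bar> ^ p)"
proof -
  have int: "integrable lborel (\<lambda>x. normal_density 0 (sqrt (b - a)) x * \<bar>x\<bar> ^ p)"
    using integrable_normal_moment_abs[of "sqrt (b - a)" 0 p] ab by simp
  have le: "(\<integral>\<^sup>+\<omega>. ennreal (max_drop W a b \<omega> ^ p) \<partial>M) \<le>
      ennreal (LINT x|lborel. normal_density 0 (sqrt (b - a)) x * \<bar>x\<bar> ^ p)"
    using nn_integral_max_drop_power_le[OF assms] nn_integral_eq_integral[OF int] by simp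
  have "max_drop W a b \<in> borel_measurable M" 
    using ab by (intro measurable_max_drop brownian_measurable) auto
  then show i: "integrable M (\<lambda>\<omega>. max_drop W a b \<omega> ^ p)"
    using le by (intro integrableI_nonneg) (auto simp: max_drop_nonneg le_less_trans)
  show "(LINT \<omega>|M. max_drop W a b \<omega> ^ p) \<le>
      (LINT x|lborel. normal_density 0 (sqrt (b - a)) x * \<bar>x\<bar> ^ p)"
    using le nn_integral_eq_integral[OF i] by (simp add: max_drop_nonneg ennreal_le_iff)
qed

lemma expected_max_drop_le:
  assumes "0 \<le> a" "a < b"
  shows "(LINT \<omega>|M. max_drop W a b \<omega>) \<le> sqrt (2 * (b - a) / pi)"
proof -
  have "sqrt (2 * (b - a) / pi) = sqrt (b - a) * sqrt (2 / pi)"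
    by (simp only: real_sqrt_mult[symmetric]) (simp add: mult.commute)
  then show ?thesis
    using integral_max_drop_power_le[OF assms, of 1] assms
      integral_normal_moment_abs_odd[of "sqrt (b - a)" 0 0] by simp
qed

lemma even_moment_max_drop_le:
  assumes "0 \<le> a" "a < b" "0 < k"
  shows "(LINT \<omega>|M. max_drop W a b \<omega> ^ (2 * k)) \<le> fact (2 * k) / (2 ^ k * fact k) * (b - a) ^ k"
proof -
  have "(LINT x|lborel. normal_density 0 (sqrt (b - a)) x * x ^ (2 * k)) =
      fact (2 * k) / ((2 / (b - a)) ^ k * fact k)"
    using integral_normal_moment_even[of "sqrt (b - a)" 0 k] assms by simp
  also have "\<dots> = fact (2 * k) / (2 ^ k * fact k) * (b - a) ^ k"
    using assms by (simp add: power_divide)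
  finally show ?thesis
    using integral_max_drop_power_le[OF assms(1,2), of "2 * k"] assms
    by (simp add: power_even_abs)
qed

end

section \<open>Initial values in a band determined by the path\<close>

text \<open>
  The information carried by the Brownian path alone. The filtration may be larger, and it
  may contain information about the initial value.
\<close>

definition path_algebra :: "'a measure \<Rightarrow> (real \<Rightarrow> 'a \<Rightarrow> real) \<Rightarrow> 'a measure" where
  "path_algebra M W = vimage_algebra (space M) (\<lambda>\<omega>. \<lambda>t\<in>{0..}. W t \<omega>) (Pi\<^sub>M {0..} (\<lambda>_. borel))"

lemma space_path_algebra: "space (path_algebra M W) = space M"
  by (simp add: path_algebra_def)

lemma measurable_path_algebra:
  assumes "0 \<le> t"
  shows "W t \<in> borel_measurable (path_algebra M W)"
proof -
  have "(\<lambda>\<omega>. \<lambda>t\<in>{0..}. W t \<omega>) \<in> path_algebra M W \<rightarrow>\<^sub>M Pi\<^sub>M {0..} (\<lambda>_. borel)"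
    unfolding path_algebra_def
    by (rule measurable_vimage_algebra1) (auto simp: space_PiM)
  from measurable_compose[OF this measurable_component_singleton[of t "{0..}"]] assms
  show ?thesis by simp
qed

text \<open>
  Fubini for independent variables: the band may be frozen while \<open>X\<close> is integrated out.
\<close>

lemma (in prob_space) prob_indep_band:
  fixes X D U :: "'a \<Rightarrow> real"
  assumes indep: "indep_set (sets (vimage_algebra (space M) X borel)) (sets G)"
    and G: "space G = space M" and X: "X \<in> borel_measurable M"
    and DU: "D \<in> borel_measurable G" "U \<in> borel_measurable G"
  shows "emeasure M {\<omega>\<in>space M. D \<omega> < X \<omega> \<and> X \<omega> \<le> U \<omega>} =
    (\<integral>\<^sup>+\<omega>. emeasure M {\<omega>'\<in>space M. D \<omega> < X \<omega>' \<and> X \<omega>' \<le> U \<omega>} \<partial>M)"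
proof -
  have GM: "sets G \<subseteq> sets M" using indep_setD_ev2[OF indep] .
  have "subalgebra M G" using GM G by (simp add: subalgebra_def)
  then have [measurable]: "D \<in> borel_measurable M" "U \<in> borel_measurable M"
    using DU by (auto intro: measurable_from_subalg)
  note [measurable] = X
  \<comment> \<open>Both random variables take values in the plane, so that \<^const>\<open>indep_var\<close> applies to them.\<close>
  define X' where "X' \<omega> = (X \<omega>, 0::real)" for \<omega>
  define Y' where "Y' \<omega> = (D \<omega>, U \<omega>)" for \<omega>
  define B2 where "B2 = (borel \<Otimes>\<^sub>M borel :: (real \<times> real) measure)"
  have rv [measurable]: "X' \<in> M \<rightarrow>\<^sub>M B2" "Y' \<in> M \<rightarrow>\<^sub>M B2"
    unfolding X'_def[abs_def] Y'_def[abs_def] B2_def by measurable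
  have YG: "Y' \<in> G \<rightarrow>\<^sub>M B2" unfolding Y'_def[abs_def] B2_def using DU by measurable
  have XV: "X' \<in> vimage_algebra (space M) X borel \<rightarrow>\<^sub>M B2"
  proof -
    have [measurable]: "X \<in> vimage_algebra (space M) X borel \<rightarrow>\<^sub>M borel"
      by (rule measurable_vimage_algebra1) simp
    show ?thesis unfolding X'_def[abs_def] B2_def by measurable
  qed
  have iv: "indep_var B2 X' B2 Y'"
    unfolding indep_var_eq
  proof (intro conjI rv)
    have 1: "sigma_sets (space M) {X' -` A \<inter> space M |A. A \<in> sets B2} \<subseteq> sets (vimage_algebra (space M) X borel)"
      using measurable_sets[OF XV]
        sets.sigma_sets_subset[of "{X' -` A \<inter> space M |A. A \<in> sets B2}" "vimage_algebra (space M) X borel"]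
      by auto
    have 2: "sigma_sets (space M) {Y' -` A \<inter> space M |A. A \<in> sets B2} \<subseteq> sets G"
      using measurable_sets[OF YG] sets.sigma_sets_subset[of "{Y' -` A \<inter> space M |A. A \<in> sets B2}" G] G by auto
    show "indep_set (sigma_sets (space M) {X' -` A \<inter> space M |A. A \<in> sets B2})
        (sigma_sets (space M) {Y' -` A \<inter> space M |A. A \<in> sets B2})"
      using indep unfolding indep_set_def
      by (rule indep_sets_mono_sets) (use 1 2 in \<open>auto split: bool.split\<close>)
  qed
  then have dist: "distr M B2 X' \<Otimes>\<^sub>M distr M B2 Y' = distr M (B2 \<Otimes>\<^sub>M B2) (\<lambda>x. (X' x, Y' x))"
    by (simp add: indep_var_distribution_eq)
  define S where "S = {z \<in> space (B2 \<Otimes>\<^sub>M B2). fst (snd z) < fst (fst z) \<and> fst (fst z) \<le> snd (snd z)}"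
  have S: "S \<in> sets (B2 \<Otimes>\<^sub>M B2)"
    unfolding S_def B2_def by measurable
  interpret PX: prob_space "distr M B2 X'" by (rule prob_space_distr) (rule rv)
  interpret PY: prob_space "distr M B2 Y'" by (rule prob_space_distr) (rule rv)
  interpret P: pair_sigma_finite "distr M B2 X'" "distr M B2 Y'" ..
  have "emeasure M {\<omega>\<in>space M. D \<omega> < X \<omega> \<and> X \<omega> \<le> U \<omega>} =
      emeasure (distr M (B2 \<Otimes>\<^sub>M B2) (\<lambda>x. (X' x, Y' x))) S"
  proof -
    have "(\<lambda>x. (X' x, Y' x)) -` S \<inter> space M = {\<omega>\<in>space M. D \<omega> < X \<omega> \<and> X \<omega> \<le> U \<omega>}"
      by (auto simp: S_def X'_def Y'_def B2_def space_pair_measure)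
    then show ?thesis using S by (simp add: emeasure_distr)
  qed
  also have "\<dots> = (\<integral>\<^sup>+y. emeasure (distr M B2 X') ((\<lambda>x. (x, y)) -` S) \<partial>distr M B2 Y')"
    unfolding dist[symmetric] by (rule P.emeasure_pair_measure_alt2) (use S in simp)
  also have "\<dots> = (\<integral>\<^sup>+\<omega>. emeasure (distr M B2 X') ((\<lambda>x. (x, Y' \<omega>)) -` S) \<partial>M)"
  proof (rule nn_integral_distr)
    show "(\<lambda>y. emeasure (distr M B2 X') ((\<lambda>x. (x, y)) -` S)) \<in> borel_measurable (distr M B2 Y')"
      by (rule P.measurable_emeasure_Pair2) (use S in simp)
  qed (rule rv)
  also have "\<dots> = (\<integral>\<^sup>+\<omega>. emeasure M {\<omega>'\<in>space M. D \<omega> < X \<omega>' \<and> X \<omega>' \<le> U \<omega>} \<partial>M)"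
  proof (rule nn_integral_cong)
    fix \<omega>
    have "(\<lambda>x. (x, Y' \<omega>)) -` S \<in> sets B2" using S by (rule sets_Pair2)
    moreover have "X' -` ((\<lambda>x. (x, Y' \<omega>)) -` S) \<inter> space M = {\<omega>'\<in>space M. D \<omega> < X \<omega>' \<and> X \<omega>' \<le> U \<omega>}"
      by (auto simp: S_def X'_def Y'_def B2_def space_pair_measure)
    ultimately show "emeasure (distr M B2 X') ((\<lambda>x. (x, Y' \<omega>)) -` S) =
        emeasure M {\<omega>'\<in>space M. D \<omega> < X \<omega>' \<and> X \<omega>' \<le> U \<omega>}"
      by (simp add: emeasure_distr)
  qed
  finally show ?thesis .
qed

text \<open>
  The density bound is increasing, so it may be evaluated at the upper cap \<open>v\<close> of the band
  instead of at \<open>d + \<rho>\<close>. This keeps the unknown error out of the factor \<open>v\<^sup>\<beta>\<close>.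
\<close>

lemma emeasure_band_le_of_density:
  fixes X :: "'a \<Rightarrow> real"
  assumes X: "distributed M lborel X (\<lambda>x. ennreal (f x))"
    and f: "\<forall>x<0. f x = 0" "\<forall>x\<ge>0. f x \<le> B * x powr \<beta>" and "0 \<le> B" "0 \<le> \<beta>" "0 \<le> \<rho>"
  shows "emeasure M {\<omega>\<in>space M. d < X \<omega> \<and> X \<omega> \<le> min (d + \<rho>) v} \<le> ennreal (B * v powr \<beta> * \<rho>)"
proof -
  have "emeasure M {\<omega>\<in>space M. d < X \<omega> \<and> X \<omega> \<le> min (d + \<rho>) v} =
      emeasure M (X -` {d<..min (d + \<rho>) v} \<inter> space M)"
    by (rule arg_cong[where f = "emeasure M"]) auto
  also have "\<dots> = (\<integral>\<^sup>+x. ennreal (f x) * indicator {d<..min (d + \<rho>) v} x \<partial>lborel)"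
    using X by (rule distributed_emeasure) simp
  also have "\<dots> \<le> (\<integral>\<^sup>+x. ennreal (B * v powr \<beta>) * indicator {d<..d + \<rho>} x \<partial>lborel)"
  proof (rule nn_integral_mono)
    fix x :: real
    show "ennreal (f x) * indicator {d<..min (d + \<rho>) v} x \<le> ennreal (B * v powr \<beta>) * indicator {d<..d + \<rho>} x"
    proof (cases "x \<in> {d<..min (d + \<rho>) v}")
      case True
      have "f x \<le> B * v powr \<beta>"
      proof (cases "x < 0")
        case True
        then show ?thesis using f \<open>0 \<le> B\<close> by simp
      next
        case False
        then have "f x \<le> B * x powr \<beta>" using f by simp
        also have "\<dots> \<le> B * v powr \<beta>"
          using False \<open>x \<in> _\<close> \<open>0 \<le> B\<close> \<open>0 \<le> \<beta>\<close> by (intro mult_left_mono powr_mono2) auto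
        finally show ?thesis .
      qed
      then show ?thesis using True by (auto intro: ennreal_leI)
    qed simp
  qed
  also have "\<dots> = ennreal (B * v powr \<beta> * \<rho>)"
    using assms by (simp add: nn_integral_cmult_indicator ennreal_mult)
  finally show ?thesis .
qed

lemma prob_initial_value_in_band_le:
  assumes M: "prob_space M" and indep: "indep_of_process M X W"
    and X: "distributed M lborel X (\<lambda>x. ennreal (f x))"
    and f: "\<forall>x<0. f x = 0" "\<forall>x\<ge>0. f x \<le> B * x powr \<beta>" and B: "0 \<le> B" "0 \<le> \<beta>"
    and meas: "D \<in> borel_measurable (path_algebra M W)" "\<rho> \<in> borel_measurable (path_algebra M W)"
      "V \<in> borel_measurable (path_algebra M W)"
    and \<rho>: "\<And>\<omega>. 0 \<le> \<rho> \<omega>"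
    and int: "integrable M (\<lambda>\<omega>. V \<omega> powr \<beta> * \<rho> \<omega>)"
  shows "measure M {\<omega>\<in>space M. D \<omega> < X \<omega> \<and> X \<omega> \<le> min (D \<omega> + \<rho> \<omega>) (V \<omega>)} \<le>
    B * (LINT \<omega>|M. V \<omega> powr \<beta> * \<rho> \<omega>)"
proof -
  interpret prob_space M by (rule M)
  have [measurable]: "X \<in> borel_measurable M"
    using distributed_measurable[OF X] by simp
  have "emeasure M {\<omega>\<in>space M. D \<omega> < X \<omega> \<and> X \<omega> \<le> min (D \<omega> + \<rho> \<omega>) (V \<omega>)} =
    (\<integral>\<^sup>+\<omega>. emeasure M {\<omega>'\<in>space M. D \<omega> < X \<omega>' \<and> X \<omega>' \<le> min (D \<omega> + \<rho> \<omega>) (V \<omega>)} \<partial>M)"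
    by (rule prob_indep_band[OF indep[unfolded indep_of_process_def, folded path_algebra_def]])
      (use meas in \<open>auto simp: space_path_algebra\<close>)
  also have "\<dots> \<le> (\<integral>\<^sup>+\<omega>. ennreal (B * (V \<omega> powr \<beta> * \<rho> \<omega>)) \<partial>M)"
    using emeasure_band_le_of_density[OF X f B \<rho>]
    by (intro nn_integral_mono) (simp add: mult.assoc)
  also have "\<dots> = ennreal (LINT \<omega>|M. B * (V \<omega> powr \<beta> * \<rho> \<omega>))"
    using int B \<rho> by (intro nn_integral_eq_integral) auto
  finally show ?thesis
    using B \<rho> by (simp add: emeasure_eq_measure ennreal_le_iff integral_nonneg_AE)
qed

section \<open>Regularity of the loss\<close>

text \<open>
  Some \<open>T' > T\<close> still has finite \<open>H\<^sup>1\<close> norm. The room between \<open>T\<close> and \<open>T'\<close> is needed for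
  continuity of \<open>L\<close> from the right at \<open>T\<close>.
\<close>

lemma mckean_vlasov_loss_regular:
  assumes "prob_space M" and sol: "mckean_vlasov_solution M Y0 W \<alpha> L"
    and bound: "\<forall>t\<ge>0. ennreal t < explosion_time L \<longrightarrow> L t \<le> b * t powr p" and "0 < p"
    and T: "0 \<le> T" "ennreal T < explosion_time L"
  obtains T' C where "T < T'" "0 \<le> C" "\<And>t. 0 \<le> t \<Longrightarrow> t < T' \<Longrightarrow> ennreal t < explosion_time L"
    "L 0 = 0" "\<And>s t. 0 \<le> s \<Longrightarrow> s \<le> t \<Longrightarrow> t < T' \<Longrightarrow> L s \<le> L t"
    "\<And>s t. 0 \<le> s \<Longrightarrow> s \<le> t \<Longrightarrow> t < T' \<Longrightarrow> L t \<le> L s + C * sqrt (t - s)"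
proof -
  interpret prob_space M by fact
  define \<tau> where "\<tau> = hitting_time (\<lambda>t \<omega>. Y0 \<omega> + W t \<omega> - \<alpha> * L t)"
  obtain T' where T': "0 < T'" "H1_norm_sq 0 T' L < \<infinity>" "ennreal T < ennreal T'"
    using T(2) unfolding explosion_time_def less_SUP_iff by auto
  have TT': "T < T'" using T' T(1) by (simp add: ennreal_less_iff)
  have "ennreal T' \<le> explosion_time L"
    unfolding explosion_time_def using T' by (intro SUP_upper) auto
  then have below: "ennreal t < explosion_time L" if "0 \<le> t" "t < T'" for t
    using that by (meson ennreal_lessI le_less_trans less_le_trans)
  have L: "{\<omega>\<in>space M. \<tau> \<omega> \<le> ennreal t} \<in> sets M" "L t = prob {\<omega>\<in>space M. \<tau> \<omega> \<le> ennreal t}"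
    if "0 \<le> t" "t < T'" for t
    using sol that below unfolding mckean_vlasov_solution_def \<tau>_def Let_def by blast+
  have mono: "L s \<le> L t" if st: "0 \<le> s" "s \<le> t" "t < T'" for s t
  proof -
    have "prob {\<omega>\<in>space M. \<tau> \<omega> \<le> ennreal s} \<le> prob {\<omega>\<in>space M. \<tau> \<omega> \<le> ennreal t}"
      using L(1)[of t] st
      by (intro finite_measure_mono) (auto intro: order_trans ennreal_leI)
    then show ?thesis using L(2)[of s] L(2)[of t] st by simp
  qed
  have L0: "L 0 = 0"
  proof -
    have "L 0 \<le> b * 0 powr p" using bound below[of 0] T'(1) by auto
    moreover have "0 \<le> L 0" using L(2)[of 0] T'(1) by simp
    ultimately show ?thesis by simp
  qed
  obtain g where wd: "weak_derivative_on 0 T' L g"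
    and fin: "(\<integral>\<^sup>+x\<in>{0<..<T'}. ennreal ((L x)\<^sup>2 + (g x)\<^sup>2) \<partial>lborel) < \<infinity>"
    using T'(2) unfolding H1_norm_sq_def INF_less_iff by auto
  define K where "K = enn2real (\<integral>\<^sup>+x\<in>{0<..<T'}. ennreal ((L x)\<^sup>2 + (g x)\<^sup>2) \<partial>lborel)"
  have K: "(\<integral>\<^sup>+x\<in>{0<..<T'}. ennreal ((g x)\<^sup>2) \<partial>lborel) \<le> ennreal K" "0 \<le> K"
  proof -
    have "(\<integral>\<^sup>+x\<in>{0<..<T'}. ennreal ((g x)\<^sup>2) \<partial>lborel) \<le>
        (\<integral>\<^sup>+x\<in>{0<..<T'}. ennreal ((L x)\<^sup>2 + (g x)\<^sup>2) \<partial>lborel)"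
      by (intro nn_integral_mono mult_right_mono ennreal_leI) auto
    also have "\<dots> = ennreal K" using fin by (simp add: K_def)
    finally show "(\<integral>\<^sup>+x\<in>{0<..<T'}. ennreal ((g x)\<^sup>2) \<partial>lborel) \<le> ennreal K" .
  qed (simp add: K_def)
  define C where "C = (K + 1) / 2"
  have C: "0 \<le> C" using K(2) by (simp add: C_def)
  have pos: "L t \<le> L s + C * sqrt (t - s)" if "0 < s" "s \<le> t" "t < T'" for s t
    using weak_derivative_increment_le[OF wd _ K that] mono by (force simp: C_def)
  \<comment> \<open>The weak derivative only sees the open interval; the origin is reached by the growth bound.\<close>
  have zero: "L t \<le> L 0 + C * sqrt (t - 0)" if t: "0 \<le> t" "t < T'" for t
  proof (cases "t = 0")
    case False
    have "((\<lambda>s. b * s powr p + C * sqrt (t - s)) \<longlongrightarrow> b * 0 + C * sqrt (t - 0)) (at_right 0)"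
      using \<open>0 < p\<close>
      by (intro tendsto_intros tendsto_zero_powrI[where b = p])
        (auto simp: eventually_at_filter intro: tendsto_eq_intros)
    moreover have "eventually (\<lambda>s. L t \<le> b * s powr p + C * sqrt (t - s)) (at_right 0)"
      unfolding eventually_at_right_field
    proof (intro exI[of _ t] conjI allI impI)
      fix s :: real assume s: "0 < s" "s < t"
      have "L s \<le> b * s powr p" using bound below[of s] s t by simp
      then show "L t \<le> b * s powr p + C * sqrt (t - s)" using pos[of s t] s t by simp
    qed (use False t in simp)
    ultimately have "L t \<le> b * 0 + C * sqrt (t - 0)"
      by (rule tendsto_lowerbound) simp
    then show ?thesis by (simp add: L0)
  qed simp
  show thesis
  proof (rule that[OF TT' C below L0 mono])
    fix s t :: real assume "0 \<le> s" "s \<le> t" "t < T'"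
    then show "L t \<le> L s + C * sqrt (t - s)" using pos zero by (cases "s = 0") auto
  qed
qed

section \<open>Moments of the random error terms\<close>

text \<open>
  The graph of a concave function lies below its tangent at \<open>\<mu>\<close>.
\<close>

lemma powr_le_tangent:
  fixes x \<mu> \<beta> :: real
  assumes "0 \<le> x" "0 < \<mu>" "0 < \<beta>" "\<beta> \<le> 1"
  shows "x powr \<beta> \<le> \<mu> powr (\<beta> - 1) * (\<beta> * x + (1 - \<beta>) * \<mu>)"
proof (cases "x = 0")
  case False
  have "x powr \<beta> * \<mu> powr (1 - \<beta>) \<le> \<beta> * x + (1 - \<beta>) * \<mu>"
    using assms False by (intro Youngs_inequality_0) auto
  then have "\<mu> powr (\<beta> - 1) * (x powr \<beta> * \<mu> powr (1 - \<beta>)) \<le> \<mu> powr (\<beta> - 1) * (\<beta> * x + (1 - \<beta>) * \<mu>)"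
    by (rule mult_left_mono) simp
  moreover have "\<mu> powr (\<beta> - 1) * (x powr \<beta> * \<mu> powr (1 - \<beta>)) = x powr \<beta>"
    using assms by (simp add: mult.left_commute flip: powr_add)
  ultimately show ?thesis by simp
qed (use assms in simp)

text \<open>
  Jensen's inequality for the concave function \<open>x\<^sup>\<beta>\<close>; the tangent at \<open>\<mu>\<close> also provides integrability
  and allows for an upper bound \<open>\<mu>\<close> in place of the expectation.
\<close>

lemma (in prob_space)
  fixes X :: "'a \<Rightarrow> real"
  assumes X: "integrable M X" "\<And>\<omega>. 0 \<le> X \<omega>" and \<mu>: "expectation X \<le> \<mu>" "0 < \<mu>"
    and \<beta>: "0 < \<beta>" "\<beta> \<le> 1"
  shows integrable_powr: "integrable M (\<lambda>\<omega>. X \<omega> powr \<beta>)"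
    and expectation_powr_le: "expectation (\<lambda>\<omega>. X \<omega> powr \<beta>) \<le> \<mu> powr \<beta>"
proof -
  let ?t = "\<lambda>\<omega>. \<mu> powr (\<beta> - 1) * (\<beta> * X \<omega> + (1 - \<beta>) * \<mu>)"
  have t: "integrable M ?t" using X by simp
  have le: "X \<omega> powr \<beta> \<le> ?t \<omega>" for \<omega> using powr_le_tangent X \<mu> \<beta> by blast
  have [measurable]: "X \<in> borel_measurable M" using X by simp
  show i: "integrable M (\<lambda>\<omega>. X \<omega> powr \<beta>)"
    using t
  proof (rule Bochner_Integration.integrable_bound)
    show "AE \<omega> in M. norm (X \<omega> powr \<beta>) \<le> norm (?t \<omega>)"
    proof (rule AE_I2)
      fix \<omega>
      have "norm (X \<omega> powr \<beta>) \<le> ?t \<omega>" using le[of \<omega>] by simp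
      also have "\<dots> \<le> norm (?t \<omega>)" unfolding real_norm_def by (rule abs_ge_self)
      finally show "norm (X \<omega> powr \<beta>) \<le> norm (?t \<omega>)" .
    qed
  qed measurable
  have "expectation (\<lambda>\<omega>. X \<omega> powr \<beta>) \<le> expectation ?t"
    using i t le by (rule integral_mono)
  also have "\<dots> = \<mu> powr (\<beta> - 1) * (\<beta> * expectation X + (1 - \<beta>) * \<mu>)"
    using X by (simp add: prob_space)
  also have "\<dots> \<le> \<mu> powr (\<beta> - 1) * (\<beta> * \<mu> + (1 - \<beta>) * \<mu>)"
    using \<mu> \<beta> by (intro mult_left_mono add_right_mono) auto
  also have "\<dots> = \<mu> powr (\<beta> - 1) * \<mu> powr 1" using \<mu> by (simp add: algebra_simps)
  also have "\<dots> = \<mu> powr \<beta>" by (simp only: powr_add[symmetric]) simp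
  finally show "expectation (\<lambda>\<omega>. X \<omega> powr \<beta>) \<le> \<mu> powr \<beta>" .
qed

definition mesh_drop :: "(real \<Rightarrow> 'a \<Rightarrow> real) \<Rightarrow> real \<Rightarrow> nat \<Rightarrow> 'a \<Rightarrow> real" where
  "mesh_drop W h n \<omega> = (MAX j\<in>{..<n}. max_drop W (real j * h) (real (Suc j) * h) \<omega>)"

lemma max_drop_le_mesh_drop: "j < n \<Longrightarrow> max_drop W (real j * h) (real (Suc j) * h) \<omega> \<le> mesh_drop W h n \<omega>"
  unfolding mesh_drop_def by (rule Max_ge) auto

lemma mesh_drop_nonneg: "0 < n \<Longrightarrow> 0 \<le> mesh_drop W h n \<omega>"
  by (rule order_trans[OF max_drop_nonneg max_drop_le_mesh_drop])

lemma measurable_mesh_drop: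
  assumes "\<And>t. 0 \<le> t \<Longrightarrow> W t \<in> borel_measurable N" "0 \<le> h"
  shows "mesh_drop W h n \<in> borel_measurable N"
proof -
  have "(\<lambda>\<omega>. MAX j\<in>{..<n}. max_drop W (real j * h) (real (Suc j) * h) \<omega>) \<in> borel_measurable N"
  proof (rule borel_measurable_Max, simp, rule measurable_max_drop)
    fix j :: nat and t :: real assume "real j * h \<le> t"
    moreover have "0 \<le> real j * h" using assms(2) by simp
    ultimately show "W t \<in> borel_measurable N" using assms(1) by simp
  qed
  then show ?thesis by (simp add: mesh_drop_def[abs_def])
qed

lemma mesh_drop_power_le_sum:
  assumes "0 < n" "0 < \<eta>"
  shows "(mesh_drop W h n \<omega> / \<eta>) ^ p \<le> (\<Sum>j<n. (max_drop W (real j * h) (real (Suc j) * h) \<omega>) ^ p / \<eta> ^ p)"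
proof -
  let ?d = "\<lambda>j. max_drop W (real j * h) (real (Suc j) * h) \<omega>"
  have "mesh_drop W h n \<omega> \<in> ?d ` {..<n}"
    unfolding mesh_drop_def using assms(1) by (intro Max_in) auto
  then obtain j where j: "j < n" "mesh_drop W h n \<omega> = ?d j" by blast
  have "?d j ^ p / \<eta> ^ p \<le> (\<Sum>j<n. ?d j ^ p / \<eta> ^ p)"
    using j(1) assms(2) by (intro member_le_sum) (auto simp: max_drop_nonneg)
  then show ?thesis using j(2) by (simp add: power_divide)
qed

text \<open>
  The two factors are dependent; Young's inequality separates them. With
  \<open>R = \<eta> u\<close> and \<open>\<eta> = h\<^sup>1\<^sup>/\<^sup>2\<^sup>-\<^sup>\<delta>\<close> it leaves \<open>\<E> u\<^sup>2 \<le> 1 + \<E> u\<^sup>2\<^sup>k\<close>, and the maximum in \<open>u\<close> is at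
  most the sum over the mesh, whose \<open>n\<close> terms are of order \<open>h\<^sup>2\<^sup>k\<^sup>\<delta>\<close> each.
\<close>

lemma expected_mesh_drop_le:
  assumes bm: "standard_brownian_motion M F W" and "0 < T" "0 \<le> c" "0 < \<beta>" "\<beta> \<le> 1" "0 < \<delta>"
  obtains K where "0 \<le> K"
    "\<And>n. 1 \<le> n \<Longrightarrow> integrable M (\<lambda>\<omega>. (max_drop W 0 T \<omega> + c) powr \<beta> * mesh_drop W (T / real n) n \<omega>)"
    "\<And>n. 1 \<le> n \<Longrightarrow> (LINT \<omega>|M. (max_drop W 0 T \<omega> + c) powr \<beta> * mesh_drop W (T / real n) n \<omega>)
      \<le> K * (T / real n) powr (1 / 2 - \<delta>)"
proof -
  interpret prob_space M by (rule brownian_prob_space[OF bm])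
  \<comment> \<open>The sum over the mesh costs a factor \<open>n = T / h\<close>, while the moment of order \<open>2 * k\<close>
      gains \<open>h\<close> to the power \<open>2 * k * \<delta> \<ge> 1\<close>.\<close>
  define k where "k = Suc (nat \<lceil>1 / (2 * \<delta>)\<rceil>)"
  have k: "0 < k" "1 \<le> 2 * real k * \<delta>"
  proof -
    have "1 / (2 * \<delta>) \<le> real k" by (simp add: k_def) linarith
    then show "1 \<le> 2 * real k * \<delta>" using \<open>0 < \<delta>\<close> by (simp add: field_simps)
  qed (simp add: k_def)
  define m :: real where "m = fact (2 * k) / (2 ^ k * fact k)"
  define K where "K = (2 * (1 + c)\<^sup>2 + 2 * T + 1 + m * T * T powr (2 * real k * \<delta> - 1)) / 2"
  have m: "0 \<le> m" by (simp add: m_def)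
  have K: "0 \<le> K" using m \<open>0 < T\<close> by (simp add: K_def)
  define V where "V = max_drop W 0 T"
  have V: "0 \<le> V \<omega>" for \<omega> by (simp add: V_def max_drop_nonneg)
  have [measurable]: "V \<in> borel_measurable M"
    unfolding V_def by (intro measurable_max_drop brownian_measurable[OF bm])
  have V2: "integrable M (\<lambda>\<omega>. (V \<omega>)\<^sup>2)" "expectation (\<lambda>\<omega>. (V \<omega>)\<^sup>2) \<le> T"
    using integrable_max_drop_power[OF bm, of 0 T 2] even_moment_max_drop_le[OF bm, of 0 T 1] \<open>0 < T\<close>
    by (auto simp: V_def fact_numeral)
  have main: "integrable M (\<lambda>\<omega>. (V \<omega> + c) powr \<beta> * mesh_drop W (T / real n) n \<omega>) \<and>
      expectation (\<lambda>\<omega>. (V \<omega> + c) powr \<beta> * mesh_drop W (T / real n) n \<omega>)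
        \<le> K * (T / real n) powr (1 / 2 - \<delta>)" if n: "1 \<le> n" for n
  proof -
    define h where "h = T / real n"
    have h: "0 < h" "h \<le> T" "real n * h = T"
      using n \<open>0 < T\<close> by (auto simp: h_def field_simps)
    define \<eta> where "\<eta> = h powr (1 / 2 - \<delta>)"
    have \<eta>: "0 < \<eta>" using h by (simp add: \<eta>_def)
    define d where "d j = max_drop W (real j * h) (real (Suc j) * h)" for j
    define R where "R = mesh_drop W h n"
    have R: "0 \<le> R \<omega>" for \<omega> using n by (simp add: R_def mesh_drop_nonneg)
    have [measurable]: "R \<in> borel_measurable M"
      unfolding R_def using h by (intro measurable_mesh_drop brownian_measurable[OF bm]) auto
    define S where "S \<omega> = \<eta> / 2 * (2 * (1 + c)\<^sup>2 + 2 * (V \<omega>)\<^sup>2 + 1 + (\<Sum>j<n. d j \<omega> ^ (2 * k) / \<eta> ^ (2 * k)))" for \<omega>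
    have le: "(V \<omega> + c) powr \<beta> * R \<omega> \<le> S \<omega>" for \<omega>
    proof -
      define a where "a = (V \<omega> + c) powr \<beta>"
      define u where "u = R \<omega> / \<eta>"
      have u: "0 \<le> u" "R \<omega> = \<eta> * u" using R[of \<omega>] \<eta> by (auto simp: u_def)
      have "a \<le> 1 powr (\<beta> - 1) * (\<beta> * (V \<omega> + c) + (1 - \<beta>) * 1)"
        unfolding a_def using V[of \<omega>] assms by (intro powr_le_tangent) auto
      also have "\<dots> \<le> (V \<omega> + c) + 1"
      proof -
        have "\<beta> * (V \<omega> + c) \<le> 1 * (V \<omega> + c)"
          using V[of \<omega>] assms by (intro mult_right_mono) auto
        then show ?thesis using assms by simp
      qed
      finally have "a\<^sup>2 \<le> ((V \<omega> + c) + 1)\<^sup>2" 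
        by (rule power_mono) (simp add: a_def)
      also have "\<dots> \<le> 2 * (1 + c)\<^sup>2 + 2 * (V \<omega>)\<^sup>2"
        using zero_le_power2[of "1 + c - V \<omega>"] by (simp add: power2_eq_square algebra_simps)
      finally have a2: "a\<^sup>2 \<le> 2 * (1 + c)\<^sup>2 + 2 * (V \<omega>)\<^sup>2" .
      have "u\<^sup>2 \<le> 1 + u ^ (2 * k)"
      proof (cases "u \<le> 1")
        case True
        then have "u\<^sup>2 \<le> 1" using u by (simp add: power_le_one)
        moreover have "0 \<le> u ^ (2 * k)" using u by simp
        ultimately show ?thesis by linarith
      next
        case False
        then have "u ^ 2 \<le> u ^ (2 * k)" using k by (intro power_increasing) auto
        then show ?thesis by simp
      qed
      also have "u ^ (2 * k) \<le> (\<Sum>j<n. d j \<omega> ^ (2 * k) / \<eta> ^ (2 * k))"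
        unfolding u_def R_def d_def using n \<eta> by (intro mesh_drop_power_le_sum) auto
      finally have u2: "u\<^sup>2 \<le> 1 + (\<Sum>j<n. d j \<omega> ^ (2 * k) / \<eta> ^ (2 * k))" by simp
      have "a * u \<le> (a\<^sup>2 + u\<^sup>2) / 2"
        using zero_le_power2[of "a - u"] by (simp add: power2_eq_square algebra_simps)
      then have "a * u \<le> (2 * (1 + c)\<^sup>2 + 2 * (V \<omega>)\<^sup>2 + 1 + (\<Sum>j<n. d j \<omega> ^ (2 * k) / \<eta> ^ (2 * k))) / 2"
        using a2 u2 by simp
      then have "\<eta> * (a * u) \<le> S \<omega>"
        unfolding S_def using \<eta> by (simp add: mult_left_mono)
      then show ?thesis by (simp add: u(2) a_def mult_ac)
    qed
    have dj: "integrable M (\<lambda>\<omega>. d j \<omega> ^ (2 * k))" "expectation (\<lambda>\<omega>. d j \<omega> ^ (2 * k)) \<le> m * h ^ k" for j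
    proof -
      have j: "0 \<le> real j * h" "real j * h < real (Suc j) * h" "real (Suc j) * h - real j * h = h"
        using h by (auto simp: algebra_simps)
      show "integrable M (\<lambda>\<omega>. d j \<omega> ^ (2 * k))"
        unfolding d_def using integrable_max_drop_power[OF bm j(1,2)] k by simp
      show "expectation (\<lambda>\<omega>. d j \<omega> ^ (2 * k)) \<le> m * h ^ k"
        unfolding d_def using even_moment_max_drop_le[OF bm j(1,2) k(1)] j(3) by (simp add: m_def)
    qed
    have S: "integrable M S"
      unfolding S_def[abs_def] using V2(1) dj(1) by auto
    have int: "integrable M (\<lambda>\<omega>. (V \<omega> + c) powr \<beta> * R \<omega>)"
      using S
    proof (rule Bochner_Integration.integrable_bound)
      show "AE \<omega> in M. norm ((V \<omega> + c) powr \<beta> * R \<omega>) \<le> norm (S \<omega>)"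
      proof (rule AE_I2)
        fix \<omega>
        have "norm ((V \<omega> + c) powr \<beta> * R \<omega>) \<le> S \<omega>" using le[of \<omega>] R[of \<omega>] by (simp add: abs_mult)
        also have "\<dots> \<le> norm (S \<omega>)" by simp
        finally show "norm ((V \<omega> + c) powr \<beta> * R \<omega>) \<le> norm (S \<omega>)" .
      qed
    qed measurable
    have "expectation (\<lambda>\<omega>. (V \<omega> + c) powr \<beta> * R \<omega>) \<le> expectation S"
      using int S le by (rule integral_mono)
    also have "\<dots> = \<eta> / 2 * (2 * (1 + c)\<^sup>2 + 2 * expectation (\<lambda>\<omega>. (V \<omega>)\<^sup>2) + 1
        + (\<Sum>j<n. expectation (\<lambda>\<omega>. d j \<omega> ^ (2 * k)) / \<eta> ^ (2 * k)))"
      unfolding S_def[abs_def] using V2(1) dj(1) by (simp add: prob_space)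
    also have "\<dots> \<le> \<eta> / 2 * (2 * (1 + c)\<^sup>2 + 2 * T + 1 + (\<Sum>j<n. m * h ^ k / \<eta> ^ (2 * k)))"
      using \<eta> V2(2) dj(2) by (intro mult_left_mono add_mono sum_mono divide_right_mono) auto
    also have "(\<Sum>j<n. m * h ^ k / \<eta> ^ (2 * k)) = m * (real n * (h ^ k / \<eta> ^ (2 * k)))"
      by simp
    also have "h ^ k / \<eta> ^ (2 * k) = h powr (2 * real k * \<delta>)"
    proof -
      have "\<eta> ^ (2 * k) = h powr ((1 / 2 - \<delta>) * real (2 * k))"
        using h \<eta> by (simp add: \<eta>_def powr_powr flip: powr_realpow)
      moreover have "h ^ k = h powr real k" using h by (simp add: powr_realpow)
      ultimately have "h ^ k / \<eta> ^ (2 * k) = h powr (real k - (1 / 2 - \<delta>) * real (2 * k))"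
        by (simp add: powr_diff)
      also have "real k - (1 / 2 - \<delta>) * real (2 * k) = 2 * real k * \<delta>" by (simp add: algebra_simps)
      finally show ?thesis .
    qed
    also have "real n * h powr (2 * real k * \<delta>) = T * h powr (2 * real k * \<delta> - 1)"
    proof -
      have "h powr (2 * real k * \<delta>) = h * h powr (2 * real k * \<delta> - 1)"
        using h by (simp add: powr_diff)
      then show ?thesis using h(3) by (simp add: mult.assoc[symmetric])
    qed
    also have "\<eta> / 2 * (2 * (1 + c)\<^sup>2 + 2 * T + 1 + m * (T * h powr (2 * real k * \<delta> - 1))) \<le>
        \<eta> / 2 * (2 * (1 + c)\<^sup>2 + 2 * T + 1 + m * (T * T powr (2 * real k * \<delta> - 1)))"
      using \<eta> m h k \<open>0 < T\<close> by (intro mult_left_mono add_left_mono powr_mono2) auto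
    also have "\<dots> = K * \<eta>" by (simp add: K_def)
    finally show ?thesis using int by (simp add: R_def h_def \<eta>_def)
  qed
  show thesis
    by (rule that[OF K]) (use main in \<open>auto simp: V_def\<close>)
qed

section \<open>Comparison of the two losses\<close>

text \<open>
  The hitting time is an infimum over all later times as well, also those where \<open>Y\<close> is not known to
  be continuous. Right-continuity at \<open>t\<close> rules out that it equals \<open>t\<close> without a hit up to \<open>t\<close>.
\<close>

lemma hitting_time_le_imp_hit:
  assumes cont: "continuous_on {0..<u} (\<lambda>s. Y s \<omega>)" and t: "0 \<le> t" "t < u"
    and hit: "hitting_time Y \<omega> \<le> ennreal t"
  shows "\<exists>s\<in>{0..t}. Y s \<omega> \<le> 0"
proof (rule ccontr)
  assume no: "\<not> (\<exists>s\<in>{0..t}. Y s \<omega> \<le> 0)"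
  then have "0 < Y t \<omega>" using t by force
  moreover have "((\<lambda>s. Y s \<omega>) \<longlongrightarrow> Y t \<omega>) (at t within {0..<u})"
    using cont t by (simp add: continuous_on_def)
  ultimately have "eventually (\<lambda>s. 0 < Y s \<omega>) (at t within {0..<u})"
    by (simp add: order_tendstoD)
  then obtain d where d: "0 < d" "\<And>s. s \<in> {0..<u} \<Longrightarrow> s \<noteq> t \<Longrightarrow> dist s t < d \<Longrightarrow> 0 < Y s \<omega>"
    unfolding eventually_at by blast
  define e where "e = min d (u - t)"
  have e: "0 < e" using d t by (simp add: e_def)
  have "ennreal (t + e) \<le> hitting_time Y \<omega>"
    unfolding hitting_time_def
  proof (rule INF_greatest)
    fix s assume s: "s \<in> {s. 0 \<le> s \<and> Y s \<omega> \<le> 0}"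
    have "t + e \<le> s"
    proof (rule ccontr)
      assume "\<not> t + e \<le> s"
      then have "0 < Y s \<omega>"
        using s no d(2)[of s] by (cases "s \<le> t") (force simp: e_def dist_real_def)+
      then show False using s by simp
    qed
    then show "ennreal (t + e) \<le> ennreal s" by (rule ennreal_leI)
  qed
  then have "ennreal (t + e) \<le> ennreal t" using hit by (rule order_trans)
  then show False using t e by (simp add: ennreal_le_iff)
qed

lemma mesh_interval_exists:
  fixes h s :: real
  assumes "0 \<le> s" "s \<le> real i * h" "0 < i"
  shows "\<exists>j<i. real j * h \<le> s \<and> s \<le> real (Suc j) * h"
  using assms
proof (induction i)
  case (Suc i)
  show ?case
  proof (cases "0 < i \<and> s \<le> real i * h")
    case True
    then show ?thesis using Suc by (meson less_SucI)
  next
    case False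
    then show ?thesis using Suc.prems by (intro exI[of _ i]) auto
  qed
qed simp

text \<open>
  The scheme monitors the barrier at fewer times and, by induction, with a smaller loss, so it
  detects fewer hits.
\<close>

lemma discretized_loss_le_loss:
  assumes "prob_space M" and sol: "mckean_vlasov_solution M Y0 W \<alpha> L" and "0 < \<alpha>" "0 < h"
    and below: "ennreal (real n * h) < explosion_time L"
    and Lt: "discretized_loss M Y0 W \<alpha> h n Lt" and "i \<le> n"
  shows "Lt i \<le> L (real i * h)"
  using \<open>i \<le> n\<close>
proof (induction i rule: less_induct)
  case (less i)
  interpret prob_space M by fact
  define \<tau> where "\<tau> = hitting_time (\<lambda>t \<omega>. Y0 \<omega> + W t \<omega> - \<alpha> * L t)"
  have "ennreal (real i * h) \<le> ennreal (real n * h)"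
    using less.prems \<open>0 < h\<close> by (intro ennreal_leI mult_right_mono) auto
  then have "ennreal (real i * h) < explosion_time L" using below by (rule le_less_trans)
  then have L: "{\<omega>\<in>space M. \<tau> \<omega> \<le> ennreal (real i * h)} \<in> sets M"
    "L (real i * h) = prob {\<omega>\<in>space M. \<tau> \<omega> \<le> ennreal (real i * h)}"
    using sol \<open>0 < h\<close> unfolding mckean_vlasov_solution_def \<tau>_def Let_def by auto
  have "Lt i = prob {\<omega>\<in>space M. \<exists>j<i. Y0 \<omega> + W (real j * h) \<omega> - \<alpha> * Lt j \<le> 0}"
    using Lt[unfolded discretized_loss_iff[OF \<open>0 < h\<close>]] less.prems by blast
  also have "\<dots> \<le> prob {\<omega>\<in>space M. \<tau> \<omega> \<le> ennreal (real i * h)}"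
  proof (rule finite_measure_mono[OF _ L(1)], safe)
    fix \<omega> j assume j: "j < i" "Y0 \<omega> + W (real j * h) \<omega> - \<alpha> * Lt j \<le> 0"
    have "\<alpha> * Lt j \<le> \<alpha> * L (real j * h)"
      using less.IH[of j] less.prems j \<open>0 < \<alpha>\<close> by simp
    then have "\<tau> \<omega> \<le> ennreal (real j * h)"
      unfolding \<tau>_def hitting_time_def using j \<open>0 < h\<close> by (intro INF_lower) auto
    also have "\<dots> \<le> ennreal (real i * h)"
      using j \<open>0 < h\<close> by (intro ennreal_leI mult_right_mono) auto
    finally show "\<tau> \<omega> \<le> ennreal (real i * h)" .
  qed
  finally show ?case using L(2) by simp
qed

text \<open>
  Here the lower end \<open>D\<close> of the band is the condition that the scheme sees no hit before \<open>t\<^sub>i\<close>. The two upper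
  ends compare a hit of the true path at time \<open>s\<close> with the value of the scheme at
  the last mesh point before \<open>s\<close>, and with the extreme values of \<open>W\<close> and \<open>L\<close> on \<open>[0, T]\<close>.
\<close>

lemma loss_minus_discretized_loss_le:
  fixes M :: "'a measure"
  assumes bm: "standard_brownian_motion M F W" and indep: "indep_of_process M Y0 W"
    and Y0: "distributed M lborel Y0 (\<lambda>x. ennreal (f x))"
    and f: "\<forall>x<0. f x = 0" "\<forall>x\<ge>0. f x \<le> B * x powr \<beta>" and B: "0 \<le> B" "0 < \<beta>" "\<beta> \<le> 1"
    and sol: "mckean_vlasov_solution M Y0 W \<alpha> L" and \<alpha>: "0 < \<alpha>"
    and T: "0 < T" "T < T'" and below: "\<And>t. 0 \<le> t \<Longrightarrow> t < T' \<Longrightarrow> ennreal t < explosion_time L"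
    and mono: "\<And>s t. 0 \<le> s \<Longrightarrow> s \<le> t \<Longrightarrow> t < T' \<Longrightarrow> L s \<le> L t"
    and hoelder: "\<And>s t. 0 \<le> s \<Longrightarrow> s \<le> t \<Longrightarrow> t < T' \<Longrightarrow> L t \<le> L s + C * sqrt (t - s)" and C: "0 \<le> C"
    and c: "0 \<le> c" "\<alpha> * L T \<le> c"
    and n: "1 \<le> n" and Lt: "discretized_loss M Y0 W \<alpha> (T / real n) n Lt"
    and E: "0 \<le> E" "\<And>j. j \<le> n \<Longrightarrow> L (real j * (T / real n)) - Lt j \<le> E"
    and i: "0 < i" "i \<le> n"
    and int: "integrable M (\<lambda>\<omega>. (max_drop W 0 T \<omega> + c) powr \<beta>)"
      "integrable M (\<lambda>\<omega>. (max_drop W 0 T \<omega> + c) powr \<beta> * mesh_drop W (T / real n) n \<omega>)"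
  shows "L (real i * (T / real n)) - Lt i \<le>
    B * ((\<alpha> * E + \<alpha> * C * sqrt (T / real n)) * (LINT \<omega>|M. (max_drop W 0 T \<omega> + c) powr \<beta>)
      + (LINT \<omega>|M. (max_drop W 0 T \<omega> + c) powr \<beta> * mesh_drop W (T / real n) n \<omega>))"
proof -
  interpret prob_space M by (rule brownian_prob_space[OF bm])
  define h where "h = T / real n"
  have h: "0 < h" "real n * h = T" using n T by (auto simp: h_def)
  define R where "R = mesh_drop W h n"
  define V where "V = max_drop W 0 T"
  define \<rho> where "\<rho> \<omega> = \<alpha> * E + \<alpha> * C * sqrt h + R \<omega>" for \<omega>
  define D where "D \<omega> = (MAX j\<in>{..<i}. \<alpha> * Lt j - W (real j * h) \<omega>)" for \<omega>
  define \<tau> where "\<tau> = hitting_time (\<lambda>t \<omega>. Y0 \<omega> + W t \<omega> - \<alpha> * L t)"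
  define A where "A = {\<omega>\<in>space M. \<tau> \<omega> \<le> ennreal (real i * h)}"
  define A' where "A' = {\<omega>\<in>space M. \<exists>j<i. Y0 \<omega> + W (real j * h) \<omega> - \<alpha> * Lt j \<le> 0}"
  define Band where "Band = {\<omega>\<in>space M. D \<omega> < Y0 \<omega> \<and> Y0 \<omega> \<le> min (D \<omega> + \<rho> \<omega>) (V \<omega> + c)}"
  have ih: "0 \<le> real i * h" "real i * h \<le> T" "real i * h < T'"
  proof -
    have "real i * h \<le> real n * h" using i h by (intro mult_right_mono) auto
    then show "real i * h \<le> T" "real i * h < T'" using h T by auto
  qed (use h in simp)
  have R: "0 \<le> R \<omega>" for \<omega> using n by (simp add: R_def mesh_drop_nonneg)
  have \<rho>: "0 \<le> \<rho> \<omega>" for \<omega> using R[of \<omega>] \<alpha> E(1) C h by (simp add: \<rho>_def)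
  have [measurable]: "Y0 \<in> borel_measurable M" using distributed_measurable[OF Y0] by simp
  have meas: "D \<in> borel_measurable N" "\<rho> \<in> borel_measurable N" "V \<in> borel_measurable N"
    if W: "\<And>t. 0 \<le> t \<Longrightarrow> W t \<in> borel_measurable N" for N :: "'a measure"
  proof -
    have [measurable]: "R \<in> borel_measurable N"
      unfolding R_def using h by (intro measurable_mesh_drop W) auto
    show "\<rho> \<in> borel_measurable N" unfolding \<rho>_def by measurable
    show "V \<in> borel_measurable N" unfolding V_def by (intro measurable_max_drop W)
    show "D \<in> borel_measurable N"
      unfolding D_def[abs_def]
    proof (rule borel_measurable_Max)
      fix j
      have [measurable]: "W (real j * h) \<in> borel_measurable N" using h by (intro W) simp
      show "(\<lambda>\<omega>. \<alpha> * Lt j - W (real j * h) \<omega>) \<in> borel_measurable N" by measurable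
    qed simp
  qed
  note [measurable] = meas[OF brownian_measurable[OF bm]]
  have A: "A \<in> sets M" "L (real i * h) = prob A"
    using sol below[OF ih(1,3)] ih(1)
    unfolding A_def \<tau>_def mckean_vlasov_solution_def Let_def by auto
  have A': "A' \<in> sets M"
    unfolding A'_def
  proof (rule sets.sets_Collect_countable_Ex)
    fix j
    have [measurable]: "W (real j * h) \<in> borel_measurable M"
      using h by (intro brownian_measurable[OF bm]) simp
    show "{\<omega>\<in>space M. j < i \<and> Y0 \<omega> + W (real j * h) \<omega> - \<alpha> * Lt j \<le> 0} \<in> sets M"
      by measurable
  qed
  have Lt_i: "Lt i = prob A'"
    using Lt[folded h_def, unfolded discretized_loss_iff[OF h(1)]] i unfolding A'_def by blast
  have contL: "continuous_on {0..<T'} L"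
  proof (rule continuous_onI)
    fix x e :: real assume x: "x \<in> {0..<T'}" and e: "0 < e"
    define d where "d = (e / (C + 1))\<^sup>2"
    have d: "0 < d" using e C by (simp add: d_def)
    have "dist (L y) (L x) \<le> e" if y: "y \<in> {0..<T'}" "dist y x < d" for y
    proof -
      have "\<bar>L y - L x\<bar> \<le> C * sqrt \<bar>y - x\<bar>"
        using x y mono[of x y] mono[of y x] hoelder[of x y] hoelder[of y x]
        by (cases "x \<le> y") auto
      also have "\<dots> \<le> C * sqrt d"
        using y C by (intro mult_left_mono real_sqrt_le_mono) (auto simp: dist_real_def)
      also have "\<dots> = C * (e / (C + 1))" using e C by (simp add: d_def)
      also have "\<dots> \<le> e" using e C by (simp add: field_simps)
      finally show ?thesis by (simp add: dist_real_def)
    qed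
    then show "\<exists>d>0. \<forall>y\<in>{0..<T'}. dist y x < d \<longrightarrow> dist (L y) (L x) \<le> e" using d by blast
  qed
  have incl: "\<omega> \<in> Band"
    if w: "\<omega> \<in> A - A'" and W0: "W 0 \<omega> = 0" and cont: "continuous_on {0..} (\<lambda>t. W t \<omega>)" for \<omega>
  proof -
    have "\<omega> \<in> space M" using w by (simp add: A_def)
    have "continuous_on {0..<T'} (\<lambda>s. Y0 \<omega> + W s \<omega> - \<alpha> * L s)"
    proof -
      have "{0..<T'} \<subseteq> {0..}" by (auto simp: subset_iff)
      from contL continuous_on_subset[OF cont this] show ?thesis by (intro continuous_intros)
    qed
    moreover have "\<tau> \<omega> \<le> ennreal (real i * h)" using w by (simp add: A_def)
    ultimately obtain s where s: "s \<in> {0..real i * h}" "Y0 \<omega> + W s \<omega> - \<alpha> * L s \<le> 0"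
      using hitting_time_le_imp_hit[of T' "\<lambda>t \<omega>. Y0 \<omega> + W t \<omega> - \<alpha> * L t" \<omega> "real i * h"] ih
      unfolding \<tau>_def by blast
    have sT: "0 \<le> s" "s \<le> T" "s < T'" using s ih T by auto
    have "D \<omega> < Y0 \<omega>"
      unfolding D_def using w i \<open>\<omega> \<in> space M\<close> by (subst Max_less_iff) (force simp: A'_def)+
    moreover have "Y0 \<omega> \<le> V \<omega> + c"
    proof -
      have "W 0 \<omega> - W s \<omega> \<le> V \<omega>"
        unfolding V_def using sT T continuous_on_subset[OF cont, of "{0..T}"]
        by (intro drop_le_max_drop) auto
      moreover have "\<alpha> * L s \<le> \<alpha> * L T" using mono[of s T] sT T \<alpha> by simp
      ultimately show ?thesis using s(2) c W0 by linarith
    qed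
    moreover have "Y0 \<omega> \<le> D \<omega> + \<rho> \<omega>"
    proof -
      obtain j where j: "j < i" "real j * h \<le> s" "s \<le> real (Suc j) * h"
        using mesh_interval_exists[of s i h] s(1) i(1) by auto
      have jh: "0 \<le> real j * h" "real j * h < real (Suc j) * h" using h by auto
      have 1: "W (real j * h) \<omega> - W s \<omega> \<le> R \<omega>"
      proof -
        have "W (real j * h) \<omega> - W s \<omega> \<le> max_drop W (real j * h) (real (Suc j) * h) \<omega>"
          using j jh continuous_on_subset[OF cont, of "{real j * h..real (Suc j) * h}"]
          by (intro drop_le_max_drop) auto
        also have "\<dots> \<le> R \<omega>" unfolding R_def using j i by (intro max_drop_le_mesh_drop) simp
        finally show ?thesis .
      qed
      have "L s \<le> L (real j * h) + C * sqrt (s - real j * h)" using hoelder[of "real j * h" s] jh j sT by simp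
      moreover have "C * sqrt (s - real j * h) \<le> C * sqrt h"
        using j(3) C by (intro mult_left_mono real_sqrt_le_mono) (auto simp: algebra_simps)
      moreover have "L (real j * h) - Lt j \<le> E" unfolding h_def using j i by (intro E) simp
      ultimately have "L s \<le> Lt j + E + C * sqrt h" by linarith
      then have "\<alpha> * L s \<le> \<alpha> * (Lt j + E + C * sqrt h)" using \<alpha> by simp
      then have 2: "\<alpha> * L s \<le> \<alpha> * Lt j + \<alpha> * E + \<alpha> * C * sqrt h" by (simp add: algebra_simps)
      have "\<alpha> * Lt j - W (real j * h) \<omega> \<le> D \<omega>"
        unfolding D_def using j by (intro Max_ge) auto
      then show ?thesis using 1 2 s(2) unfolding \<rho>_def by linarith
    qed
    ultimately show ?thesis using \<open>\<omega> \<in> space M\<close> by (simp add: Band_def)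
  qed
  have "AE \<omega> in M. W 0 \<omega> = 0 \<and> continuous_on {0..} (\<lambda>t. W t \<omega>)"
    using bm by (simp add: standard_brownian_motion_def)
  then have "AE \<omega> in M. \<omega> \<in> A - A' \<longrightarrow> \<omega> \<in> Band"
    by eventually_elim (use incl in blast)
  moreover have "Band \<in> sets M" unfolding Band_def by measurable
  ultimately have "prob (A - A') \<le> prob Band" by (rule finite_measure_mono_AE)
  moreover have "prob A \<le> prob (A - A') + prob A'"
  proof -
    have "prob A \<le> prob ((A - A') \<union> A')" using A A' by (intro finite_measure_mono) auto
    also have "\<dots> \<le> prob (A - A') + prob A'" using A A' by (intro measure_Un_le) auto
    finally show ?thesis .
  qed
  ultimately have "L (real i * h) - Lt i \<le> prob Band" using A(2) Lt_i by simp
  also have "\<dots> \<le> B * (LINT \<omega>|M. (V \<omega> + c) powr \<beta> * \<rho> \<omega>)"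
    unfolding Band_def
  proof (rule prob_initial_value_in_band_le[OF prob_space_axioms indep Y0 f])
    note m = meas[OF measurable_path_algebra, of M]
    show "D \<in> borel_measurable (path_algebra M W)" "\<rho> \<in> borel_measurable (path_algebra M W)"
      by (rule m; assumption)+
    have [measurable]: "V \<in> borel_measurable (path_algebra M W)" by (rule m; assumption)
    show "(\<lambda>\<omega>. V \<omega> + c) \<in> borel_measurable (path_algebra M W)" by measurable
    show "integrable M (\<lambda>\<omega>. (V \<omega> + c) powr \<beta> * \<rho> \<omega>)"
      using int unfolding \<rho>_def V_def R_def h_def by (simp add: distrib_left)
  qed (use B \<rho> in auto)
  also have "(LINT \<omega>|M. (V \<omega> + c) powr \<beta> * \<rho> \<omega>) =
      (\<alpha> * E + \<alpha> * C * sqrt h) * (LINT \<omega>|M. (V \<omega> + c) powr \<beta>) + (LINT \<omega>|M. (V \<omega> + c) powr \<beta> * R \<omega>)"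
    using int unfolding \<rho>_def V_def R_def h_def by (simp add: distrib_left distrib_right mult_ac)
  finally show ?thesis by (simp add: V_def R_def h_def)
qed

section \<open>Rate of convergence\<close>

theorem theorem1:
  fixes M :: "'a measure"
    and F :: "real \<Rightarrow> 'a measure"
    and W :: "real \<Rightarrow> 'a \<Rightarrow> real"
    and Y0 :: "'a \<Rightarrow> real"
    and f L :: "real \<Rightarrow> real"
    and \<alpha> \<beta> B Bt Tstar T :: real
  assumes "\<alpha> > 0" and "T > 0"
    and "standard_brownian_motion M F W"
    and "\<forall>\<omega>\<in>space M. Y0 \<omega> \<ge> 0"
    and "indep_of_process M Y0 W"
    and "\<forall>x. f x \<ge> 0" and "\<forall>x<0. f x = 0"
    and "distributed M lborel Y0 (\<lambda>x. ennreal (f x))"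
    and "0 < \<beta>" and "\<beta> \<le> 1"
    and "\<forall>x\<ge>0. f x \<le> B * x powr \<beta>"
    and "\<forall>b. (\<forall>x\<ge>0. f x \<le> b * x powr \<beta>) \<longrightarrow> B \<le> b"
    and "mckean_vlasov_solution M Y0 W \<alpha> L"
    and "\<forall>t\<ge>0. ennreal t < explosion_time L \<longrightarrow> L t \<le> Bt * t powr ((1 + \<beta>) / 2)"
    and "\<forall>b. (\<forall>t\<ge>0. ennreal t < explosion_time L \<longrightarrow> L t \<le> b * t powr ((1 + \<beta>) / 2)) \<longrightarrow> Bt \<le> b"
    and "Tstar \<ge> 0"
    and "\<alpha> * B * (sqrt (2 * Tstar / pi) + \<alpha> * Bt * Tstar powr ((1 + \<beta>) / 2)) powr \<beta> = 1"
    and "T < Tstar" and "ennreal T < explosion_time L"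
  shows "\<forall>\<delta>>0. \<exists>C>0. \<forall>n\<ge>1. \<forall>Lt. discretized_loss M Y0 W \<alpha> (T / real n) n Lt \<longrightarrow>
    (MAX i\<in>{0..n}. \<bar>Lt i - L (real i * (T / real n))\<bar>) \<le> C * (T / real n) powr (1 / 2 - \<delta>)"
proof (intro allI impI)
  fix \<delta> :: real assume \<delta>: "0 < \<delta>"
  note \<alpha> = \<open>\<alpha> > 0\<close> and T = \<open>T > 0\<close> and bm = \<open>standard_brownian_motion M F W\<close>
    and sol = \<open>mckean_vlasov_solution M Y0 W \<alpha> L\<close> and \<beta> = \<open>0 < \<beta>\<close> \<open>\<beta> \<le> 1\<close>
    and contraction_Tstar = assms(17)
  interpret prob_space M by (rule brownian_prob_space[OF bm])
  obtain T' CL where T': "T < T'" and CL: "0 \<le> CL"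
    and below: "\<And>t. 0 \<le> t \<Longrightarrow> t < T' \<Longrightarrow> ennreal t < explosion_time L" and L0: "L 0 = 0"
    and mono: "\<And>s t. 0 \<le> s \<Longrightarrow> s \<le> t \<Longrightarrow> t < T' \<Longrightarrow> L s \<le> L t"
    and hoelder: "\<And>s t. 0 \<le> s \<Longrightarrow> s \<le> t \<Longrightarrow> t < T' \<Longrightarrow> L t \<le> L s + CL * sqrt (t - s)"
  proof (rule mckean_vlasov_loss_regular[OF prob_space_axioms sol assms(14) _ _ assms(19)])
    show "0 < (1 + \<beta>) / 2" "0 \<le> T" using \<beta> T by auto
  qed blast
  have B: "0 \<le> B"
  proof -
    have "0 \<le> f 1" using assms(6) by blast
    also have "f 1 \<le> B * 1 powr \<beta>" using assms(11)[rule_format, of 1] by simp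
    finally show ?thesis by simp
  qed
  have LT: "L T \<le> Bt * T powr ((1 + \<beta>) / 2)" "0 \<le> L T"
    using assms(14,19) T mono[of 0 T] T' L0 by auto
  have Bt: "0 \<le> Bt"
  proof -
    have "0 \<le> Bt * T powr ((1 + \<beta>) / 2)" using LT by simp
    then show ?thesis using T by (simp add: zero_le_mult_iff)
  qed
  define c where "c = \<alpha> * (Bt * T powr ((1 + \<beta>) / 2))"
  have c: "0 \<le> c" "\<alpha> * L T \<le> c" using \<alpha> Bt LT by (auto simp: c_def)
  define \<mu> where "\<mu> = sqrt (2 * T / pi) + c"
  have \<mu>: "0 < \<mu>" using T c by (simp add: \<mu>_def add_pos_nonneg)
  \<comment> \<open>The contraction factor: at \<open>Tstar\<close> in place of \<open>T\<close> it would be \<open>1\<close>.\<close>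
  define q where "q = \<alpha> * B * \<mu> powr \<beta>"
  have q: "0 \<le> q" "q < 1"
  proof -
    have "\<mu> < sqrt (2 * Tstar / pi) + \<alpha> * Bt * Tstar powr ((1 + \<beta>) / 2)"
    proof -
      have "sqrt (2 * T / pi) < sqrt (2 * Tstar / pi)"
        using \<open>T < Tstar\<close> by (simp add: divide_strict_right_mono)
      moreover have "c \<le> \<alpha> * (Bt * Tstar powr ((1 + \<beta>) / 2))"
        unfolding c_def using \<alpha> Bt T \<beta> \<open>T < Tstar\<close> by (intro mult_left_mono powr_mono2) auto
      ultimately show ?thesis unfolding \<mu>_def mult.assoc by (rule add_less_le_mono)
    qed
    then have less: "\<mu> powr \<beta> < (sqrt (2 * Tstar / pi) + \<alpha> * Bt * Tstar powr ((1 + \<beta>) / 2)) powr \<beta>"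
      using \<mu> \<beta> by (intro powr_less_mono2) auto
    have "B \<noteq> 0" using contraction_Tstar by auto
    then have "0 < \<alpha> * B" using B \<alpha> by simp
    from mult_strict_left_mono[OF less this] show "q < 1"
      using contraction_Tstar by (simp add: q_def)
    show "0 \<le> q" using B \<alpha> by (simp add: q_def)
  qed
  obtain K where K: "0 \<le> K"
    and K_int: "\<And>n. 1 \<le> n \<Longrightarrow> integrable M (\<lambda>\<omega>. (max_drop W 0 T \<omega> + c) powr \<beta> * mesh_drop W (T / real n) n \<omega>)"
    and K_le: "\<And>n. 1 \<le> n \<Longrightarrow> expectation (\<lambda>\<omega>. (max_drop W 0 T \<omega> + c) powr \<beta> * mesh_drop W (T / real n) n \<omega>)
      \<le> K * (T / real n) powr (1 / 2 - \<delta>)"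
    using expected_mesh_drop_le[OF bm T c(1) \<beta> \<delta>] by blast
  have V: "integrable M (\<lambda>\<omega>. max_drop W 0 T \<omega> + c)" "expectation (\<lambda>\<omega>. max_drop W 0 T \<omega> + c) \<le> \<mu>"
    using integrable_max_drop_power[OF bm, of 0 T 1] expected_max_drop_le[OF bm, of 0 T] T
    by (auto simp: \<mu>_def prob_space)
  have Vc: "0 \<le> max_drop W 0 T \<omega> + c" for \<omega> using max_drop_nonneg[of W 0 T \<omega>] c by simp
  note V_int = integrable_powr[OF V(1) Vc V(2) \<mu> \<beta>] and V_le = expectation_powr_le[OF V(1) Vc V(2) \<mu> \<beta>]
  define K' where "K' = (q * CL * T powr \<delta> + B * K) / (1 - q)"
  have K': "0 \<le> K'" using q K CL B by (simp add: K'_def)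
  show "\<exists>C>0. \<forall>n\<ge>1. \<forall>Lt. discretized_loss M Y0 W \<alpha> (T / real n) n Lt \<longrightarrow>
    (MAX i\<in>{0..n}. \<bar>Lt i - L (real i * (T / real n))\<bar>) \<le> C * (T / real n) powr (1 / 2 - \<delta>)"
  proof (intro exI[of _ "K' + 1"] conjI allI impI)
    fix n :: nat and Lt assume n: "1 \<le> n" and Lt: "discretized_loss M Y0 W \<alpha> (T / real n) n Lt"
    define h where "h = T / real n"
    have h: "0 < h" "h \<le> T" "real n * h = T" using n T by (auto simp: h_def field_simps)
    define \<eta> where "\<eta> = h powr (1 / 2 - \<delta>)"
    have \<eta>: "0 < \<eta>" using h by (simp add: \<eta>_def)
    define e where "e i = L (real i * h) - Lt i" for i
    have e_nonneg: "0 \<le> e i" if "i \<le> n" for i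
      using discretized_loss_le_loss[OF prob_space_axioms sol \<alpha> h(1) _ Lt[folded h_def] that]
        assms(19) h(3) by (simp add: e_def)
    define E where "E = (MAX i\<in>{0..n}. \<bar>Lt i - L (real i * h)\<bar>)"
    have E_eq: "E = (MAX i\<in>{0..n}. e i)"
      unfolding E_def using e_nonneg by (intro arg_cong[where f = Max] image_cong) (auto simp: e_def)
    have e_le: "e i \<le> E" if "i \<le> n" for i
      unfolding E_eq using that by (intro Max_ge) auto
    have E_nonneg: "0 \<le> E" using e_nonneg[of 0] e_le[of 0] by simp
    have step: "e i \<le> q * E + (q * CL * T powr \<delta> + B * K) * \<eta>" if "i \<le> n" for i
    proof (cases "i = 0")
      case True
      have "Lt 0 = 0" using Lt by (simp add: discretized_loss_def Let_def)
      then have "e i = 0" using True L0 by (simp add: e_def)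
      then show ?thesis using q CL B K \<eta> E_nonneg by simp
    next
      case False
      have sqrt_h: "sqrt h \<le> T powr \<delta> * \<eta>"
      proof -
        have "sqrt h = h powr \<delta> * \<eta>"
          using h by (simp add: \<eta>_def powr_half_sqrt flip: powr_add)
        also have "\<dots> \<le> T powr \<delta> * \<eta>" using h \<delta> \<eta> by (intro mult_right_mono powr_mono2) auto
        finally show ?thesis .
      qed
      have "e i \<le> B * ((\<alpha> * E + \<alpha> * CL * sqrt h) * expectation (\<lambda>\<omega>. (max_drop W 0 T \<omega> + c) powr \<beta>)
          + expectation (\<lambda>\<omega>. (max_drop W 0 T \<omega> + c) powr \<beta> * mesh_drop W h n \<omega>))"
        unfolding e_def h_def
        using loss_minus_discretized_loss_le[OF bm assms(5,8,7,11) B \<beta> sol \<alpha> T T' below mono hoelder CL c n Lt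
            E_nonneg _ _ that V_int K_int[OF n]] e_le False
        by (auto simp: e_def h_def)
      also have "\<dots> \<le> B * ((\<alpha> * E + \<alpha> * CL * sqrt h) * \<mu> powr \<beta> + K * \<eta>)"
        using V_le K_le[OF n] B \<alpha> CL E_nonneg h
        by (intro mult_left_mono add_mono) (auto simp: h_def \<eta>_def)
      also have "\<dots> = q * E + q * CL * sqrt h + B * K * \<eta>"
        by (simp add: q_def algebra_simps)
      also have "\<dots> \<le> q * E + q * CL * (T powr \<delta> * \<eta>) + B * K * \<eta>"
        using sqrt_h q CL by (intro add_right_mono add_left_mono mult_left_mono) auto
      finally show ?thesis by (simp add: algebra_simps)
    qed
    have "E \<le> q * E + (q * CL * T powr \<delta> + B * K) * \<eta>"
      unfolding E_eq by (subst Max_le_iff) (use step E_eq in auto)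
    then have "E * (1 - q) \<le> (q * CL * T powr \<delta> + B * K) * \<eta>" by (simp add: algebra_simps)
    then have "E \<le> (q * CL * T powr \<delta> + B * K) * \<eta> / (1 - q)" using q by (simp add: pos_le_divide_eq)
    also have "\<dots> = K' * \<eta>" by (simp add: K'_def)
    also have "\<dots> \<le> (K' + 1) * \<eta>" using \<eta> by simp
    finally show "(MAX i\<in>{0..n}. \<bar>Lt i - L (real i * (T / real n))\<bar>) \<le> (K' + 1) * (T / real n) powr (1 / 2 - \<delta>)"
      by (simp add: E_def h_def \<eta>_def)
  qed (use K' in simp)
qed

end
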